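(* Let $f:V\to W$ be a morphism of complex abelian varieties, both endowed with polarizations. There are complementary abelian subvarieties $X,X'\subset V$, complementary abelian subvarieties $Y,Y'\subset W$, and an isogeny $g:X\to Y$ such that the diagram $$\begin{array}{ccc} X\times X'&\longrightarrow&V\\ {\scriptstyle g\times 0}\downarrow&&\downarrow{\scriptstyle f}\\ Y\times Y'&\longrightarrow&W \end{array}$$ is commutative, where the horizontal arrows are isogenies, the sums of the given embeddings, and where $g\times 0$ is the map $(x,x')\mapsto(g(x),0)$. The diagram is uniquely determined by the polarizations (that is, given $f$ and the polarizations of $V$ and $W$, the subvarieties $X,X',Y,Y'$ and the isogeny $g$ are unique).
   Context: Morphisms of abelian varieties are group homomorphisms. For a polarized abelian variety $V$ with polarization $L_V$, two abelian subvarieties $X,X'\subset V$ are complementary if the sum map $s:X\times X'\to V$, $(x,x')\mapsto x+x'$, is an isogeny and $s^*L_V=p^*L_X\otimes p'^*L_{X'}$ in the Néron–Severi group of $X\times X'$, where $L_X,L_{X'}$ are the restrictions of $L_V$ to $X,X'$ and $p,p'$ are the two projections. By the classical Poincaré reducibility theorem every abelian subvariety of a polarized abelian variety has a unique complementary abelian subvariety. *)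

theory Defs
  imports "HOL-Analysis.Analysis" "HOL-Algebra.Coset"
begin

section \<open>Complex tori\<close>

text \<open>
  A complex torus is a group \<open>T\<close> (the group of points) together with its exponential map,
  a surjective homomorphism from the complex vector space \<open>Lie T\<close> whose kernel is a lattice;
  so \<open>T\<close> is \<open>Lie T / lattice T\<close>.  The tangent space \<open>Lie T\<close> is a complex subspace of some
  \<open>complex ^ 'n\<close>, so that every dimension (including 0) occurs, and the values of \<open>expm T\<close>
  outside \<open>Lie T\<close> are irrelevant.
\<close>

record ('p, 'n) ctorus = "'p monoid" +
  Lie :: "(complex ^ 'n) set"
  expm :: "complex ^ 'n \<Rightarrow> 'p"

definition lattice :: "('p, 'n::finite) ctorus \<Rightarrow> (complex ^ 'n) set" where
  "lattice T = {v \<in> Lie T. expm T v = \<one>\<^bsub>T\<^esub>}"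

text \<open>Below, \<open>span\<close> is the real span.\<close>

definition complex_torus :: "('p, 'n::finite) ctorus \<Rightarrow> bool" where
  "complex_torus T \<longleftrightarrow>
     comm_group T \<and>
     vec.subspace (Lie T) \<and>
     expm T ` Lie T = carrier T \<and>
     (\<forall>u \<in> Lie T. \<forall>v \<in> Lie T. expm T (u + v) = expm T u \<otimes>\<^bsub>T\<^esub> expm T v) \<and>
     discrete (lattice T) \<and>
     span (lattice T) = Lie T"

definition vpair :: "complex ^ 'n \<Rightarrow> complex ^ 'm \<Rightarrow> complex ^ ('n::finite + 'm::finite)" where
  "vpair x y = (\<chi> i. case i of Inl j \<Rightarrow> x $ j | Inr k \<Rightarrow> y $ k)"

definition vfst :: "complex ^ ('n::finite + 'm::finite) \<Rightarrow> complex ^ 'n" where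
  "vfst z = (\<chi> i. z $ Inl i)"

definition vsnd :: "complex ^ ('n::finite + 'm::finite) \<Rightarrow> complex ^ 'm" where
  "vsnd z = (\<chi> i. z $ Inr i)"

definition prod_torus ::
  "('p, 'n::finite) ctorus \<Rightarrow> ('q, 'm::finite) ctorus \<Rightarrow> ('p \<times> 'q, 'n + 'm) ctorus" where
  "prod_torus S T =
     \<lparr>carrier = carrier S \<times> carrier T,
      monoid.mult = (\<lambda>(x, y) (x', y'). (x \<otimes>\<^bsub>S\<^esub> x', y \<otimes>\<^bsub>T\<^esub> y')),
      one = (\<one>\<^bsub>S\<^esub>, \<one>\<^bsub>T\<^esub>),
      Lie = {vpair u v | u v. u \<in> Lie S \<and> v \<in> Lie T},
      expm = (\<lambda>z. (expm S (vfst z), expm T (vsnd z)))\<rparr>"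

text \<open>
  The structure induced on a subgroup \<open>Z\<close> of \<open>T\<close>: its tangent space consists of the generators of
  the one-parameter subgroups of \<open>T\<close> that stay in \<open>Z\<close>.
\<close>

definition sub_torus :: "('p, 'n::finite) ctorus \<Rightarrow> 'p set \<Rightarrow> ('p, 'n) ctorus" where
  "sub_torus T Z =
     \<lparr>carrier = Z,
      monoid.mult = monoid.mult T,
      one = one T,
      Lie = {v \<in> Lie T. \<forall>t::real. expm T (t *\<^sub>R v) \<in> Z},
      expm = expm T\<rparr>"

section \<open>Morphisms\<close>

text \<open>
  Local inverses of the exponential maps are the charts of a torus.  A map of tori is thus
  holomorphic iff it lifts locally to holomorphic maps between the tangent spaces.
\<close>

definition torus_holomorphic ::
  "('p, 'n::finite) ctorus \<Rightarrow> ('q, 'm::finite) ctorus \<Rightarrow> ('p \<Rightarrow> 'q) \<Rightarrow> bool" where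
  "torus_holomorphic S T f \<longleftrightarrow>
     (\<forall>v \<in> Lie S. \<exists>A \<phi>. openin (top_of_set (Lie S)) A \<and> v \<in> A \<and> \<phi> ` A \<subseteq> Lie T \<and>
        (\<forall>u \<in> A. f (expm S u) = expm T (\<phi> u)) \<and>
        (\<forall>u \<in> A. \<exists>D. Vector_Spaces.linear (*s) (*s) D \<and> (\<phi> has_derivative D) (at u within A)))"

definition morphism ::
  "('p, 'n::finite) ctorus \<Rightarrow> ('q, 'm::finite) ctorus \<Rightarrow> ('p \<Rightarrow> 'q) \<Rightarrow> bool" where
  "morphism S T f \<longleftrightarrow> f \<in> hom S T \<and> torus_holomorphic S T f"

definition isogeny ::
  "('p, 'n::finite) ctorus \<Rightarrow> ('q, 'm::finite) ctorus \<Rightarrow> ('p \<Rightarrow> 'q) \<Rightarrow> bool" where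
  "isogeny S T f \<longleftrightarrow> morphism S T f \<and> f ` carrier S = carrier T \<and> finite (kernel S T f)"

text \<open>
  The analytic representation of a morphism, its linear lift to the tangent spaces, exists and is
  unique on \<open>Lie S\<close>.
\<close>

definition analytic_rep ::
  "('p, 'n::finite) ctorus \<Rightarrow> ('q, 'm::finite) ctorus \<Rightarrow> ('p \<Rightarrow> 'q) \<Rightarrow> complex ^ 'n \<Rightarrow> complex ^ 'm" where
  "analytic_rep S T f =
     (SOME F. Vector_Spaces.linear (*s) (*s) F \<and> F ` Lie S \<subseteq> Lie T \<and>
        (\<forall>v \<in> Lie S. f (expm S v) = expm T (F v)))"

section \<open>Line bundles and polarizations\<close>

text \<open>
  A line bundle on \<open>T\<close> becomes trivial on \<open>Lie T\<close> and is given by a factor of automorphy: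
  it is the quotient of \<open>Lie T \<times> \<complex>\<close> by the action \<open>l \<cdot> (v, z) = (v + l, L l v * z)\<close> of the lattice.
  Arguments outside the lattice, respectively outside \<open>Lie T\<close>, are irrelevant.
\<close>

type_synonym 'n factor = "complex ^ 'n \<Rightarrow> complex ^ 'n \<Rightarrow> complex"

definition line_bundle :: "('p, 'n::finite) ctorus \<Rightarrow> 'n factor \<Rightarrow> bool" where
  "line_bundle T L \<longleftrightarrow>
     (\<forall>l \<in> lattice T. \<forall>v \<in> Lie T. L l v \<noteq> 0) \<and>
     (\<forall>l \<in> lattice T. \<forall>v \<in> Lie T. \<exists>D. Vector_Spaces.linear (*s) (*) D \<and>
        (L l has_derivative D) (at v within Lie T)) \<and>
     (\<forall>l \<in> lattice T. \<forall>m \<in> lattice T. \<forall>v \<in> Lie T. L (l + m) v = L l (v + m) * L m v)"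

definition tensor :: "'n factor \<Rightarrow> 'n factor \<Rightarrow> ('n::finite) factor" where
  "tensor L M = (\<lambda>l v. L l v * M l v)"

definition pullback ::
  "('p, 'n::finite) ctorus \<Rightarrow> ('q, 'm::finite) ctorus \<Rightarrow> ('p \<Rightarrow> 'q) \<Rightarrow> 'm factor \<Rightarrow> 'n factor" where
  "pullback S T f L = (\<lambda>l v. L (analytic_rep S T f l) (analytic_rep S T f v))"

definition restrict_bundle :: "('p, 'n::finite) ctorus \<Rightarrow> 'p set \<Rightarrow> 'n factor \<Rightarrow> 'n factor" where
  "restrict_bundle T Z L = pullback (sub_torus T Z) T (\<lambda>x. x) L"

text \<open>
  The first Chern class, in the second cohomology group of \<open>T\<close>, that is, the group of alternating
  integral forms on the lattice.  If \<open>L l = exp (2 * pi * \<i> * g\<^sub>l)\<close> with \<open>g\<^sub>l\<close> continuous on \<open>Lie T\<close>,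
  the class takes \<open>(l, m)\<close> to \<open>g\<^sub>m (v + l) + g\<^sub>l v - g\<^sub>l (v + m) - g\<^sub>m v\<close>.  This does not depend on
  \<open>v\<close> (we take 0), and \<open>g\<^sub>l\<close> is unique up to an integer constant, which cancels.
\<close>

definition bundle_log :: "('p, 'n::finite) ctorus \<Rightarrow> 'n factor \<Rightarrow> 'n factor" where
  "bundle_log T L l =
     (SOME g. continuous_on (Lie T) g \<and>
        (\<forall>v \<in> Lie T. L l v = exp (2 * complex_of_real pi * \<i> * g v)))"

definition chern_class :: "('p, 'n::finite) ctorus \<Rightarrow> 'n factor \<Rightarrow> 'n factor" where
  "chern_class T L l m =
     bundle_log T L m l + bundle_log T L l 0 - bundle_log T L l m - bundle_log T L m 0"

text \<open>Equality in the Neron-Severi group, the image of the first Chern class.\<close>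

definition NS_eq :: "('p, 'n::finite) ctorus \<Rightarrow> 'n factor \<Rightarrow> 'n factor \<Rightarrow> bool" where
  "NS_eq T L M \<longleftrightarrow>
     (\<forall>l \<in> lattice T. \<forall>m \<in> lattice T. chern_class T L l m = chern_class T M l m)"

definition hermitian_on :: "(complex ^ 'n::finite) set \<Rightarrow> 'n factor \<Rightarrow> bool" where
  "hermitian_on U H \<longleftrightarrow>
     (\<forall>x \<in> U. \<forall>y \<in> U. \<forall>z \<in> U. H (x + y) z = H x z + H y z) \<and>
     (\<forall>c. \<forall>x \<in> U. \<forall>y \<in> U. H (c *s x) y = c * H x y) \<and>
     (\<forall>x \<in> U. \<forall>y \<in> U. H y x = cnj (H x y))"

text \<open>
  A polarization is (the class of) a positive definite line bundle: its first Chern class is the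
  imaginary part of a positive definite Hermitian form.  On a complex torus these are exactly the
  ample line bundles.
\<close>

definition polarization :: "('p, 'n::finite) ctorus \<Rightarrow> 'n factor \<Rightarrow> bool" where
  "polarization T L \<longleftrightarrow> line_bundle T L \<and>
     (\<exists>H. hermitian_on (Lie T) H \<and> (\<forall>x \<in> Lie T. x \<noteq> 0 \<longrightarrow> Re (H x x) > 0) \<and>
        (\<forall>l \<in> lattice T. \<forall>m \<in> lattice T. chern_class T L l m = complex_of_real (Im (H l m))))"

section \<open>Abelian varieties and complementary abelian subvarieties\<close>

definition abelian_variety :: "('p, 'n::finite) ctorus \<Rightarrow> bool" where
  "abelian_variety T \<longleftrightarrow> complex_torus T \<and> (\<exists>L. polarization T L)"

definition abelian_subvariety :: "('p, 'n::finite) ctorus \<Rightarrow> 'p set \<Rightarrow> bool" where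
  "abelian_subvariety T Z \<longleftrightarrow> subgroup Z T \<and> abelian_variety (sub_torus T Z)"

definition sum_map :: "('p, 'n::finite) ctorus \<Rightarrow> 'p \<times> 'p \<Rightarrow> 'p" where
  "sum_map T = (\<lambda>(x, x'). x \<otimes>\<^bsub>T\<^esub> x')"

definition complementary ::
  "('p, 'n::finite) ctorus \<Rightarrow> 'n factor \<Rightarrow> 'p set \<Rightarrow> 'p set \<Rightarrow> bool" where
  "complementary V L X X' \<longleftrightarrow>
     abelian_subvariety V X \<and> abelian_subvariety V X' \<and>
     (let SX = sub_torus V X; SX' = sub_torus V X'; P = prod_torus SX SX' in
        isogeny P V (sum_map V) \<and>
        NS_eq P (pullback P V (sum_map V) L)
          (tensor (pullback P SX fst (restrict_bundle V X L))
                  (pullback P SX' snd (restrict_bundle V X' L))))"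

end

theory Submission
  imports Defs
begin

text \<open>
  A morphism lifts to a complex linear map \<open>F\<close> between the tangent spaces
  (\<open>morphism_linear_lift\<close>), and abelian subvarieties correspond to the complex subspaces of the
  tangent space that are spanned by lattice vectors: the subvariety is the image of the subspace
  under the exponential map, and a countability argument (\<open>line_in_subspace_mod_lattice\<close>) recovers
  the subspace from its image.  The whole problem thereby becomes one of linear algebra with a
  lattice and a positive definite Hermitian form whose imaginary part \<open>E\<close>, the first Chern class of
  the polarization, is integral on the lattice.

  Equality of the two classes in the Neron-Severi group of \<open>X \<times> X'\<close> says that the mixed terms
  of \<open>E\<close> vanish (\<open>NS_eq_sum_map_iff\<close>).  As the tangent spaces are complex, this is orthogonality for the Hermitian
  form, so complements are orthogonal complements (\<open>complementaryD\<close>, \<open>complementary_orth\<close>).  That the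
  orthogonal complement of a subspace spanned by lattice vectors is again of this kind is Poincare
  reducibility.  Like the corresponding statement for the kernel of \<open>F\<close>, it is an instance of
  \<open>integral_functionals_kernel_in_span\<close>: the common zeros of finitely many functionals that are
  integral on a lattice are spanned by lattice vectors.

  Now take for \<open>X'\<close> the subvariety with tangent space \<open>ker F\<close>, for \<open>Y\<close> the image of \<open>f\<close>, whose
  tangent space is the image of \<open>F\<close>, and for \<open>X\<close> and \<open>Y'\<close> their complements.  On the orthogonal
  complement of \<open>ker F\<close> the map \<open>F\<close> is injective with the same image, so \<open>f\<close> restricts to an isogeny
  from \<open>X\<close> to \<open>Y\<close>.  Conversely, in any such diagram \<open>F\<close> vanishes on the tangent space of \<open>X'\<close> and is
  injective on that of \<open>X\<close>, whence the former is \<open>ker F\<close>; and \<open>Y = g ` X\<close> is the image of \<open>f\<close>.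
\<close>

section \<open>Real and complex linear algebra\<close>

lemma scaleR_eq_smult: "t *\<^sub>R (v :: complex ^ 'n) = complex_of_real t *s v"
  by (simp add: vec_eq_iff scaleR_conv_of_real[where 'a = complex])

lemma complex_subspace_imp_subspace:
  fixes U :: "(complex ^ 'n) set"
  assumes "vec.subspace U"
  shows "subspace U"
  using assms unfolding subspace_def vec.subspace_def by (simp add: scaleR_eq_smult)

lemma complex_linear_imp_linear:
  fixes F :: "complex ^ 'n \<Rightarrow> complex ^ 'm"
  assumes "Vector_Spaces.linear (*s) (*s) F"
  shows "linear F"
proof -
  interpret F: Vector_Spaces.linear "(*s)" "(*s)" F by fact
  show ?thesis
    by (rule linearI) (simp_all add: F.add F.scale scaleR_eq_smult)
qed

lemma complex_subspace_image:
  fixes F :: "complex ^ 'n::finite \<Rightarrow> complex ^ 'm::finite"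
  assumes F: "Vector_Spaces.linear (*s) (*s) F" and "vec.subspace U"
  shows "vec.subspace (F ` U)"
proof -
  interpret F: Vector_Spaces.linear "(*s)" "(*s)" F by fact
  show ?thesis by (rule F.subspace_image) fact
qed

text \<open>
  Linearity is only required on a subspace because a polarization determines its Hermitian form only
  on the tangent space, not on the surrounding coordinate space.
\<close>

definition real_linear_on :: "'a::real_vector set \<Rightarrow> ('a \<Rightarrow> 'b::real_vector) \<Rightarrow> bool" where
  "real_linear_on U \<phi> \<longleftrightarrow>
     (\<forall>x \<in> U. \<forall>y \<in> U. \<phi> (x + y) = \<phi> x + \<phi> y) \<and> (\<forall>c. \<forall>x \<in> U. \<phi> (c *\<^sub>R x) = c *\<^sub>R \<phi> x)"

lemma real_linear_on_sum:
  assumes \<phi>: "real_linear_on U \<phi>" and U: "subspace U" and B: "finite B" "B \<subseteq> U"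
  shows "\<phi> (\<Sum>b\<in>B. t b *\<^sub>R b) = (\<Sum>b\<in>B. t b *\<^sub>R \<phi> b)"
  using B
proof (induction B)
  case empty
  have "\<phi> (0 *\<^sub>R 0) = 0 *\<^sub>R \<phi> 0"
    using \<phi> subspace_0[OF U] unfolding real_linear_on_def by blast
  then show ?case by simp
next
  case (insert b B)
  have "(\<Sum>b\<in>B. t b *\<^sub>R b) \<in> U" "t b *\<^sub>R b \<in> U"
    using insert.prems U by (auto intro!: subspace_sum subspace_scale)
  then show ?case
    using insert \<phi> unfolding real_linear_on_def by simp
qed

lemma real_linear_on_diff:
  assumes \<phi>: "real_linear_on U \<phi>" and U: "subspace U" and "x \<in> U" "y \<in> U"
  shows "\<phi> (x - y) = \<phi> x - \<phi> y"
proof -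
  have "\<phi> (x + (-1) *\<^sub>R y) = \<phi> x + (-1) *\<^sub>R \<phi> y"
    using assms subspace_scale[OF U \<open>y \<in> U\<close>] unfolding real_linear_on_def by metis
  then show ?thesis by simp
qed

lemma real_linear_on_kernel_subspace:
  assumes \<phi>: "real_linear_on U \<phi>" and U: "subspace U"
  shows "subspace {x \<in> U. \<phi> x = 0}"
proof -
  have "\<phi> 0 = 0"
    using real_linear_on_diff[OF \<phi> U subspace_0[OF U] subspace_0[OF U]] by simp
  then show ?thesis
    using \<phi> U unfolding real_linear_on_def subspace_def by auto
qed

section \<open>Lattice points and rational subspaces\<close>

definition additive_subgroup :: "'a::ab_group_add set \<Rightarrow> bool" where
  "additive_subgroup G \<longleftrightarrow> 0 \<in> G \<and> (\<forall>x \<in> G. \<forall>y \<in> G. x - y \<in> G)"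

lemma additive_subgroup_uminus:
  "additive_subgroup G \<Longrightarrow> x \<in> G \<Longrightarrow> - x \<in> G"
  unfolding additive_subgroup_def by (metis diff_0)

lemma additive_subgroup_add:
  "additive_subgroup G \<Longrightarrow> x \<in> G \<Longrightarrow> y \<in> G \<Longrightarrow> x + y \<in> G"
  using additive_subgroup_uminus[of G y] unfolding additive_subgroup_def
  by (metis diff_minus_eq_add)

lemma additive_subgroup_sum:
  "additive_subgroup G \<Longrightarrow> (\<And>b. b \<in> B \<Longrightarrow> h b \<in> G) \<Longrightarrow> sum h B \<in> G"
  by (induction B rule: infinite_finite_induct)
     (auto simp: additive_subgroup_add, auto simp: additive_subgroup_def)

lemma additive_subgroup_int_scaleR:
  fixes x :: "'a::real_vector"
  assumes G: "additive_subgroup G" and x: "x \<in> G"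
  shows "of_int k *\<^sub>R x \<in> G"
proof -
  have nat: "of_nat n *\<^sub>R x \<in> G" for n
  proof (induction n)
    case 0 then show ?case using G by (simp add: additive_subgroup_def)
  next
    case (Suc n) then show ?case
      using additive_subgroup_add[OF G x] by (simp add: scaleR_left_distrib)
  qed
  show ?thesis
    using nat[of "nat k"] additive_subgroup_uminus[OF G nat[of "nat (- k)"]]
    by (cases "k \<ge> 0") auto
qed

text \<open>
  Translations carry a neighbourhood of 0 that isolates 0 to neighbourhoods of the same size that
  isolate the other points.
\<close>

lemma discrete_subgroup_uniform_discrete:
  fixes G :: "'a::real_normed_vector set"
  assumes G: "additive_subgroup G" and "discrete G"
  shows "uniform_discrete G"
proof -
  have "0 isolated_in G"
    using assms by (simp add: discrete_def additive_subgroup_def)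
  then obtain d where "d > 0" and d: "\<And>y. y \<in> G \<Longrightarrow> dist 0 y < d \<Longrightarrow> y = 0"
    by (metis isolated_inE_dist)
  show ?thesis
  proof (rule uniformI1)
    fix x y assume "x \<in> G" "y \<in> G" "dist x y < d"
    then show "x = y"
      using d[of "x - y"] G by (auto simp: additive_subgroup_def dist_norm norm_minus_commute)
  qed fact
qed

lemma uniform_discrete_bounded_finite:
  fixes G :: "'a::euclidean_space set"
  assumes G: "uniform_discrete G" and S: "bounded S"
  shows "finite (G \<inter> S)"
proof (rule ccontr)
  assume inf: "infinite (G \<inter> S)"
  have "bounded (G \<inter> S)" using S by (simp add: bounded_Int)
  then obtain x where "x islimpt (G \<inter> S)"
    using bounded_infinite_imp_islimpt[OF subset_refl _ inf] by blast
  then have "x islimpt G" by (rule islimpt_subset) auto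
  with G show False
    by (metis closed_limpt discrete_def isolated_in_islimpt_iff
        uniform_discrete_imp_closed uniform_discrete_imp_discrete)
qed

lemma uniform_discrete_countable:
  fixes G :: "'a::euclidean_space set"
  assumes "uniform_discrete G"
  shows "countable G"
proof -
  have "G = (\<Union>n::nat. G \<inter> cball 0 (real n))"
    using real_arch_simple by (force simp: mem_cball_0)
  moreover have "countable (\<Union>n::nat. G \<inter> cball 0 (real n))"
    by (rule countable_UN) (simp_all add: countable_finite uniform_discrete_bounded_finite assms)
  ultimately show ?thesis by simp
qed

text \<open>
  A line that is not contained in a subspace meets each of its translates at most once, so
  countably many translates cannot cover it.  This is how the tangent space of a subtorus is
  recovered from its set of points.
\<close>

lemma line_in_countably_many_translates:
  fixes U :: "'a::real_vector set"
  assumes U: "subspace U" and C: "countable C"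
    and cover: "\<And>t::real. \<exists>c \<in> C. t *\<^sub>R v - c \<in> U"
  shows "v \<in> U"
proof (rule ccontr)
  assume v: "v \<notin> U"
  obtain c where c: "\<And>t. c t \<in> C" "\<And>t. t *\<^sub>R v - c t \<in> U"
    using cover by metis
  have "inj c"
  proof (rule injI)
    fix s t assume "c s = c t"
    then have "s *\<^sub>R v - t *\<^sub>R v \<in> U"
      using subspace_diff[OF U c(2)[of s] c(2)[of t]] by simp
    then have *: "(s - t) *\<^sub>R v \<in> U" by (simp add: algebra_simps)
    show "s = t"
    proof (rule ccontr)
      assume "s \<noteq> t"
      then have "v = inverse (s - t) *\<^sub>R ((s - t) *\<^sub>R v)" by simp
      then show False using subspace_scale[OF U *] v by metis
    qed
  qed
  moreover have "countable (range c)"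
    using C c(1) by (meson countable_subset image_subsetI)
  ultimately have "countable (UNIV :: real set)"
    by (metis countable_image_inj_on)
  then show False using uncountable_UNIV_real by blast
qed

definition unit_box :: "'a::real_vector set \<Rightarrow> 'a set" where
  "unit_box B = (\<lambda>t. \<Sum>b\<in>B. t b *\<^sub>R b) ` {t. \<forall>b \<in> B. 0 \<le> t b \<and> t b \<le> 1}"

lemma unit_box_subset_span: "unit_box B \<subseteq> span B"
  unfolding unit_box_def by (auto intro!: span_sum intro: span_scale span_base)

text \<open>
  This is the bound that leaves only finitely many integral values to a functional on the box.
\<close>

lemma norm_real_linear_on_unit_box_le:
  fixes \<phi> :: "'a::real_vector \<Rightarrow> 'b::real_normed_vector"
  assumes \<phi>: "real_linear_on (span B) \<phi>" and B: "finite B" and x: "x \<in> unit_box B"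
  shows "norm (\<phi> x) \<le> (\<Sum>b\<in>B. norm (\<phi> b))"
proof -
  obtain t where t: "\<forall>b \<in> B. 0 \<le> t b \<and> t b \<le> 1" "x = (\<Sum>b\<in>B. t b *\<^sub>R b)"
    using x unfolding unit_box_def by auto
  have "\<phi> x = (\<Sum>b\<in>B. t b *\<^sub>R \<phi> b)"
    unfolding t(2) by (rule real_linear_on_sum[OF \<phi>]) (auto simp: B span_base)
  also have "norm \<dots> \<le> (\<Sum>b\<in>B. norm (t b *\<^sub>R \<phi> b))" by (rule norm_sum)
  also have "\<dots> \<le> (\<Sum>b\<in>B. norm (\<phi> b))"
    using t(1) by (intro sum_mono) (simp add: mult_left_le_one_le)
  finally show ?thesis .
qed

lemma bounded_unit_box:
  fixes B :: "'a::real_normed_vector set"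
  assumes "finite B"
  shows "bounded (unit_box B)"
  using norm_real_linear_on_unit_box_le[of B "\<lambda>x. x"] assms
  by (auto simp: bounded_iff real_linear_on_def)

text \<open>
  Rounding down the coefficients of \<open>x\<close> gives the point \<open>c\<close> of the group; the fractional parts are
  the coefficients of the remainder.
\<close>

lemma span_reduce_to_unit_box:
  assumes G: "additive_subgroup G" and B: "finite B" "B \<subseteq> G" and x: "x \<in> span B"
  obtains c where "c \<in> G" "c \<in> span B" "x - c \<in> unit_box B"
proof -
  obtain t where t: "x = (\<Sum>b\<in>B. t b *\<^sub>R b)"
    using x unfolding span_finite[OF B(1)] by auto
  define c where "c = (\<Sum>b\<in>B. of_int \<lfloor>t b\<rfloor> *\<^sub>R b)"
  have "x - c = (\<Sum>b\<in>B. frac (t b) *\<^sub>R b)"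
    unfolding t c_def frac_def by (simp add: sum_subtractf[symmetric] algebra_simps)
  then have "x - c \<in> unit_box B"
    unfolding unit_box_def
    by (intro image_eqI[where x = "\<lambda>b. frac (t b)"]) (auto simp: frac_ge_0 frac_lt_1 less_imp_le)
  moreover have "c \<in> G"
    unfolding c_def using B(2)
    by (intro additive_subgroup_sum[OF G] additive_subgroup_int_scaleR[OF G]) auto
  moreover have "c \<in> span B"
    unfolding c_def by (intro span_sum span_scale span_base)
  ultimately show thesis using that by blast
qed

text \<open>
  Reducing the multiples \<open>k *\<^sub>R x\<close> of a common zero \<open>x\<close> modulo the group leaves remainders in a
  bounded box, on which the integral functionals take finitely many values.  By the pigeonhole
  principle infinitely many remainders agree under all functionals; the differences of their
  integral parts are then common zeros in the group, and divided by \<open>k\<close> they converge to \<open>x\<close>.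
\<close>

lemma integral_functionals_kernel_in_span:
  fixes B :: "'a::euclidean_space set" and \<phi> :: "'i \<Rightarrow> 'a \<Rightarrow> real"
  assumes G: "additive_subgroup G" and B: "finite B" "B \<subseteq> G"
    and I: "finite I"
    and lin: "\<And>i. i \<in> I \<Longrightarrow> real_linear_on (span B) (\<phi> i)"
    and int: "\<And>i l. i \<in> I \<Longrightarrow> l \<in> G \<Longrightarrow> l \<in> span B \<Longrightarrow> \<phi> i l \<in> \<int>"
    and x: "x \<in> span B" "\<And>i. i \<in> I \<Longrightarrow> \<phi> i x = 0"
  shows "x \<in> span {l \<in> G. l \<in> span B \<and> (\<forall>i \<in> I. \<phi> i l = 0)}"
proof -
  define K where "K = {l \<in> G. l \<in> span B \<and> (\<forall>i \<in> I. \<phi> i l = 0)}"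
  have "\<forall>k::nat. \<exists>c. c \<in> G \<and> c \<in> span B \<and> real k *\<^sub>R x - c \<in> unit_box B"
    using span_reduce_to_unit_box[OF G B span_scale[OF x(1)]] by metis
  then obtain c where cG: "\<And>k::nat. c k \<in> G" and cB: "\<And>k. c k \<in> span B"
    and box: "\<And>k. real k *\<^sub>R x - c k \<in> unit_box B" by metis
  define r where "r k = real k *\<^sub>R x - c k" for k
  have \<phi>r: "\<phi> i (r k) = - \<phi> i (c k)" if "i \<in> I" for i k
  proof -
    \<comment> \<open>As \<open>x\<close> is a common zero, the functionals are integral on the remainders too.\<close>
    have "\<phi> i (r k) = \<phi> i (real k *\<^sub>R x) - \<phi> i (c k)"
      unfolding r_def
      by (rule real_linear_on_diff[OF lin[OF that]]) (auto simp: cB x span_scale)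
    also have "\<phi> i (real k *\<^sub>R x) = 0"
      using lin[OF that] x that unfolding real_linear_on_def by simp
    finally show ?thesis by simp
  qed
  define M where "M i = (\<Sum>b\<in>B. norm (\<phi> i b))" for i
  \<comment> \<open>The pigeonholes: the vectors of values at the remainders.\<close>
  define s where "s k = (\<lambda>i\<in>I. \<phi> i (r k))" for k
  have fin: "finite {z \<in> \<int>. \<bar>z\<bar> \<le> m}" for m :: real
  proof (rule finite_subset)
    show "{z \<in> \<int>. \<bar>z\<bar> \<le> m} \<subseteq> real_of_int ` {- \<lceil>m\<rceil>..\<lceil>m\<rceil>}"
      proof
      fix z assume "z \<in> {z \<in> \<int>. \<bar>z\<bar> \<le> m}"
      then obtain k :: int where k: "z = real_of_int k" "\<bar>real_of_int k\<bar> \<le> m"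
        by (auto elim: Ints_cases)
      then have "k \<in> {- \<lceil>m\<rceil>..\<lceil>m\<rceil>}" by (simp add: abs_le_iff) linarith
      with k(1) show "z \<in> real_of_int ` {- \<lceil>m\<rceil>..\<lceil>m\<rceil>}" by blast
    qed
  qed auto
  have "s k \<in> (\<Pi>\<^sub>E i\<in>I. {z \<in> \<int>. \<bar>z\<bar> \<le> M i})" for k
    unfolding s_def
  proof (rule PiE_I)
    fix i assume i: "i \<in> I"
    have "norm (\<phi> i (r k)) \<le> M i"
      unfolding M_def r_def by (rule norm_real_linear_on_unit_box_le[OF lin[OF i] B(1) box])
    moreover have "\<phi> i (r k) \<in> \<int>"
      using \<phi>r[OF i] int[OF i cG cB] by simp
    ultimately show "(\<lambda>i\<in>I. \<phi> i (r k)) i \<in> {z \<in> \<int>. \<bar>z\<bar> \<le> M i}" using i by simp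
  qed simp
  then have "finite (range s)"
    by (intro finite_subset[OF image_subsetI finite_PiE[OF I fin]])
  then obtain k0 where inf: "infinite {k. s k = s k0}"
    using pigeonhole_infinite[of "UNIV :: nat set" s] by auto
  obtain C where C: "\<And>y. y \<in> unit_box B \<Longrightarrow> norm y \<le> C"
    using bounded_unit_box[OF B(1)] unfolding bounded_iff by blast
  have "x \<in> closure (span K)"
    unfolding closure_approachable
  proof (intro allI impI)
    fix e :: real assume "e > 0"
    \<comment> \<open>Beyond this bound the error term, a bounded vector divided by \<open>k\<close>, is smaller than \<open>e\<close>.\<close>
    obtain k where k: "s k = s k0" "k > nat \<lceil>(C + norm (c k0)) / e\<rceil>" "k > 0"
      using infinite_nat_iff_unbounded[THEN iffD1, OF inf,
          rule_format, of "max 0 (nat \<lceil>(C + norm (c k0)) / e\<rceil>)"] by auto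
    have "c k - c k0 \<in> K"
    proof -
      have "\<phi> i (c k - c k0) = 0" if "i \<in> I" for i
        using fun_cong[OF k(1), of i] that \<phi>r real_linear_on_diff[OF lin[OF that] _ cB cB]
        by (simp add: s_def)
      then show ?thesis
        using G cG cB unfolding K_def additive_subgroup_def by (simp add: span_diff)
    qed
    then have mem: "(1 / real k) *\<^sub>R (c k - c k0) \<in> span K"
      by (intro span_scale span_base)
    have "dist ((1 / real k) *\<^sub>R (c k - c k0)) x = norm ((1 / real k) *\<^sub>R (r k + c k0))"
      using k(3) by (simp add: r_def dist_norm norm_minus_commute algebra_simps)
    also have "\<dots> \<le> (C + norm (c k0)) / real k"
      using norm_triangle_ineq[of "r k" "c k0"] C[OF box[of k]] k(3)
      by (simp add: r_def divide_right_mono)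
    also have "\<dots> < e"
    proof -
      have "(C + norm (c k0)) / e < real k" using k(2) by linarith
      then show ?thesis using \<open>e > 0\<close> k(3) by (simp add: field_simps)
    qed
    finally show "\<exists>y \<in> span K. dist y x < e" using mem by blast
  qed
  then show ?thesis unfolding K_def[symmetric] by (simp add: closure_closed)
qed

section \<open>Complex tori and their lattices\<close>

lemma complex_torusD:
  assumes "complex_torus T"
  shows "comm_group T" "vec.subspace (Lie T)" "expm T ` Lie T = carrier T"
    "\<And>u v. u \<in> Lie T \<Longrightarrow> v \<in> Lie T \<Longrightarrow> expm T (u + v) = expm T u \<otimes>\<^bsub>T\<^esub> expm T v"
    "discrete (lattice T)" "span (lattice T) = Lie T"
  using assms unfolding complex_torus_def by auto

lemma torus_group: "complex_torus T \<Longrightarrow> group T"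
  by (simp add: complex_torusD(1) comm_group.axioms(2))

lemma torus_Lie_subspace: "complex_torus T \<Longrightarrow> subspace (Lie T)"
  by (simp add: complex_subspace_imp_subspace complex_torusD(2))

lemma expm_closed: "complex_torus T \<Longrightarrow> v \<in> Lie T \<Longrightarrow> expm T v \<in> carrier T"
  using complex_torusD(3) by blast

lemma expm_zero:
  assumes T: "complex_torus T"
  shows "expm T 0 = \<one>\<^bsub>T\<^esub>"
proof -
  interpret group T by (rule torus_group[OF T])
  have 0: "0 \<in> Lie T" using torus_Lie_subspace[OF T] by (rule subspace_0)
  have "expm T 0 \<otimes>\<^bsub>T\<^esub> expm T 0 = expm T 0"
    using complex_torusD(4)[OF T 0 0] by simp
  then show ?thesis using expm_closed[OF T 0] by (metis r_cancel_one')
qed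

lemma expm_uminus:
  assumes T: "complex_torus T" and v: "v \<in> Lie T"
  shows "expm T (- v) = inv\<^bsub>T\<^esub> expm T v"
proof -
  interpret group T by (rule torus_group[OF T])
  have v': "- v \<in> Lie T" using torus_Lie_subspace[OF T] v by (rule subspace_neg)
  have "expm T (- v) \<otimes>\<^bsub>T\<^esub> expm T v = \<one>\<^bsub>T\<^esub>"
    using complex_torusD(4)[OF T v' v] expm_zero[OF T] by simp
  then show ?thesis
    using expm_closed[OF T v] expm_closed[OF T v'] by (metis inv_equality)
qed

lemma expm_diff:
  assumes T: "complex_torus T" and "u \<in> Lie T" "v \<in> Lie T"
  shows "expm T (u - v) = expm T u \<otimes>\<^bsub>T\<^esub> inv\<^bsub>T\<^esub> expm T v"
  using complex_torusD(4)[OF T, of u "- v"] expm_uminus[OF T] assms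
    subspace_neg[OF torus_Lie_subspace[OF T]] by simp

lemma expm_eq_iff:
  assumes T: "complex_torus T" and uv: "u \<in> Lie T" "v \<in> Lie T"
  shows "expm T u = expm T v \<longleftrightarrow> u - v \<in> lattice T"
proof -
  interpret group T by (rule torus_group[OF T])
  have "u - v \<in> Lie T" using torus_Lie_subspace[OF T] uv by (rule subspace_diff)
  moreover have "expm T u \<otimes>\<^bsub>T\<^esub> inv\<^bsub>T\<^esub> expm T v = \<one>\<^bsub>T\<^esub> \<longleftrightarrow> expm T u = expm T v"
    using expm_closed[OF T] uv by (metis inv_closed inv_equality inv_inv r_inv)
  ultimately show ?thesis
    using expm_diff[OF T uv] by (simp add: lattice_def)
qed

lemma lattice_subset_Lie: "lattice T \<subseteq> Lie T"
  by (auto simp: lattice_def)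

lemma lattice_additive_subgroup:
  assumes T: "complex_torus T"
  shows "additive_subgroup (lattice T)"
  unfolding additive_subgroup_def
proof (intro conjI ballI)
  show "0 \<in> lattice T"
    using expm_zero[OF T] subspace_0[OF torus_Lie_subspace[OF T]] by (simp add: lattice_def)
next
  fix u v assume "u \<in> lattice T" "v \<in> lattice T"
  then show "u - v \<in> lattice T"
    using expm_eq_iff[OF T, of u v] by (simp add: lattice_def)
qed

lemma lattice_uniform_discrete: "complex_torus T \<Longrightarrow> uniform_discrete (lattice T)"
  by (simp add: complex_torusD(5) discrete_subgroup_uniform_discrete lattice_additive_subgroup)

lemma lattice_countable: "complex_torus T \<Longrightarrow> countable (lattice T)"
  by (simp add: lattice_uniform_discrete uniform_discrete_countable)

lemma torus_lattice_basis:
  assumes T: "complex_torus T"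
  obtains B where "finite B" "B \<subseteq> lattice T" "span B = Lie T"
proof -
  obtain B where B: "B \<subseteq> lattice T" "independent B" "lattice T \<subseteq> span B"
    using maximal_independent_subset by blast
  have "span B = Lie T"
    using span_mono[OF B(1)] span_minimal[OF B(3) subspace_span] complex_torusD(6)[OF T] by blast
  then show thesis using that B independent_imp_finite by blast
qed

text \<open>
  Every tangent vector can be moved by a lattice vector into the parallelepiped of a lattice basis.
  This is the compactness of the torus in the form in which finiteness of kernels uses it.
\<close>

lemma torus_bounded_domain:
  assumes T: "complex_torus T"
  obtains D where "bounded D" "D \<subseteq> Lie T" "expm T ` D = carrier T"
proof -
  obtain B where B: "finite B" "B \<subseteq> lattice T" "span B = Lie T"
    using torus_lattice_basis[OF T] .
  have "carrier T \<subseteq> expm T ` unit_box B"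
  proof
    fix p assume "p \<in> carrier T"
    then obtain v where v: "v \<in> Lie T" "p = expm T v" using complex_torusD(3)[OF T] by blast
    obtain c where c: "c \<in> lattice T" "v - c \<in> unit_box B"
      using span_reduce_to_unit_box[OF lattice_additive_subgroup[OF T] B(1,2)] v(1) B(3) by metis
    have "v - c \<in> Lie T" using c(2) unit_box_subset_span B(3) by blast
    then have "expm T v = expm T (v - c)" using expm_eq_iff[OF T v(1)] c(1) by simp
    then show "p \<in> expm T ` unit_box B" using v(2) c(2) by simp
  qed
  then have "expm T ` unit_box B = carrier T"
    using unit_box_subset_span[of B] B(3) complex_torusD(3)[OF T] by blast
  then show thesis
    using that[of "unit_box B"] bounded_unit_box[OF B(1)] unit_box_subset_span[of B] B(3) by blast
qed

text \<open>
  Two tangent vectors with the same image differ by one of the countably many lattice vectors, so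
  the line lies in countably many translates of \<open>U\<close>.
\<close>

lemma line_in_subspace_mod_lattice:
  assumes T: "complex_torus T" and U: "subspace U" "U \<subseteq> Lie T" and v: "v \<in> Lie T"
    and line: "\<And>t::real. expm T (t *\<^sub>R v) \<in> expm T ` U"
  shows "v \<in> U"
proof (rule line_in_countably_many_translates[OF U(1) lattice_countable[OF T]])
  fix t :: real
  obtain u where u: "u \<in> U" "expm T (t *\<^sub>R v) = expm T u" using line[of t] by blast
  have "t *\<^sub>R v - u \<in> lattice T"
    using u expm_eq_iff[OF T] U(2) subspace_scale[OF torus_Lie_subspace[OF T] v]
    by (metis subsetD)
  then show "\<exists>c \<in> lattice T. t *\<^sub>R v - c \<in> U"
    using u(1) by (intro bexI[of _ "t *\<^sub>R v - u"]) simp_all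
qed

text \<open>
  The preimage of a point under the exponential map is empty or a translate of the lattice, hence
  countable.
\<close>

lemma line_in_finite_set:
  assumes T: "complex_torus T" and v: "v \<in> Lie T" and K: "finite K"
    and line: "\<And>t::real. expm T (t *\<^sub>R v) \<in> K"
  shows "v = 0"
proof -
  define C where "C = (\<Union>p\<in>K. {w \<in> Lie T. expm T w = p})"
  have "countable {w \<in> Lie T. expm T w = p}" for p
  proof (cases "\<exists>w0 \<in> Lie T. expm T w0 = p")
    case True
    then obtain w0 where w0: "w0 \<in> Lie T" "expm T w0 = p" by blast
    have "{w \<in> Lie T. expm T w = p} \<subseteq> (\<lambda>l. l + w0) ` lattice T"
    proof
      fix w assume "w \<in> {w \<in> Lie T. expm T w = p}"
      then have "w - w0 \<in> lattice T" using expm_eq_iff[OF T, of w w0] w0 by simp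
      then show "w \<in> (\<lambda>l. l + w0) ` lattice T" by (intro image_eqI[of _ _ "w - w0"]) simp_all
    qed
    then show ?thesis by (rule countable_subset) (simp add: lattice_countable[OF T])
  next
    case False
    then have "{w \<in> Lie T. expm T w = p} = {}" by blast
    then show ?thesis by (simp only: countable_empty)
  qed
  then have C: "countable C" unfolding C_def using K by (simp add: countable_finite)
  have "v \<in> {0}"
  proof (rule line_in_countably_many_translates[OF subspace_single_0 C])
    fix t :: real
    have "t *\<^sub>R v \<in> C"
      unfolding C_def using line subspace_scale[OF torus_Lie_subspace[OF T] v] by simp
    then show "\<exists>c \<in> C. t *\<^sub>R v - c \<in> {0}" by force
  qed
  then show ?thesis by simp
qed

lemma lattice_line_trivial:
  assumes T: "complex_torus T" and line: "\<And>t::real. t *\<^sub>R v \<in> lattice T"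
  shows "v = 0"
  using line_in_finite_set[OF T, of v "{\<one>\<^bsub>T\<^esub>}"] line[of 1] line by (simp add: lattice_def)

section \<open>Lifting morphisms to tangent spaces\<close>

text \<open>
  The property by which \<open>analytic_rep\<close> is selected.
\<close>

definition linear_lift ::
  "('p, 'n::finite) ctorus \<Rightarrow> ('q, 'm::finite) ctorus \<Rightarrow> ('p \<Rightarrow> 'q) \<Rightarrow>
    (complex ^ 'n \<Rightarrow> complex ^ 'm) \<Rightarrow> bool" where
  "linear_lift S T f F \<longleftrightarrow> Vector_Spaces.linear (*s) (*s) F \<and> F ` Lie S \<subseteq> Lie T \<and>
     (\<forall>v \<in> Lie S. f (expm S v) = expm T (F v))"

text \<open>
  Two lifts differ at every \<open>t *\<^sub>R v\<close> by a lattice vector, and a line of lattice vectors is trivial.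
\<close>

lemma linear_lift_analytic_rep:
  assumes T: "complex_torus T" and S: "subspace (Lie S)" and F: "linear_lift S T f F"
  shows "linear_lift S T f (analytic_rep S T f)"
    and "v \<in> Lie S \<Longrightarrow> analytic_rep S T f v = F v"
proof -
  have *: "linear_lift S T f (analytic_rep S T f)"
  proof -
    have "analytic_rep S T f = (SOME F. linear_lift S T f F)"
      unfolding analytic_rep_def linear_lift_def ..
    then show ?thesis using someI[of "linear_lift S T f", OF F] by simp
  qed
  then show "linear_lift S T f (analytic_rep S T f)" .
  define G where "G = analytic_rep S T f"
  assume v: "v \<in> Lie S"
  have lin: "linear F" "linear G"
    using F * complex_linear_imp_linear unfolding linear_lift_def G_def by blast+
  have "G v - F v = 0"
  proof (rule lattice_line_trivial[OF T])
    fix t :: real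
    have tv: "t *\<^sub>R v \<in> Lie S" using S v by (rule subspace_scale)
    have "expm T (G (t *\<^sub>R v)) = expm T (F (t *\<^sub>R v))"
      using F * tv unfolding linear_lift_def G_def by metis
    moreover have "G (t *\<^sub>R v) \<in> Lie T" "F (t *\<^sub>R v) \<in> Lie T"
      using F * tv unfolding linear_lift_def G_def by blast+
    ultimately have "G (t *\<^sub>R v) - F (t *\<^sub>R v) \<in> lattice T"
      using expm_eq_iff[OF T] by blast
    then show "t *\<^sub>R (G v - F v) \<in> lattice T"
      using lin by (simp add: linear_scale scaleR_diff_right)
  qed
  then show "analytic_rep S T f v = F v" by (simp add: G_def)
qed

lemma linear_lift_holomorphic:
  assumes F: "linear_lift S T f F"
  shows "torus_holomorphic S T f"
proof -
  have "linear F" using F by (simp add: linear_lift_def complex_linear_imp_linear)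
  then have "bounded_linear F" by (simp add: linear_conv_bounded_linear)
  then have "(F has_derivative F) (at u within Lie S)" for u
    by (rule bounded_linear_imp_has_derivative)
  then show ?thesis
    using F unfolding torus_holomorphic_def linear_lift_def
    by (intro ballI exI[of _ "Lie S"] exI[of _ F]) auto
qed

lemma linear_lift_lattice:
  assumes "linear_lift S T f F" and "f \<one>\<^bsub>S\<^esub> = \<one>\<^bsub>T\<^esub>" and "l \<in> lattice S"
  shows "F l \<in> lattice T"
  using assms unfolding linear_lift_def lattice_def by force

text \<open>
  A map that commutes with halving is determined by its values near 0, so it coincides with its
  derivative there.
\<close>

lemma halving_map_eq_derivative:
  fixes \<psi> D :: "'a::real_normed_vector \<Rightarrow> 'b::real_normed_vector"
  assumes LS: "subspace U"
    and inA: "\<And>u. u \<in> U \<Longrightarrow> norm u < e \<Longrightarrow> u \<in> A"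
    and linD: "linear D" and \<psi>D: "(\<psi> has_derivative D) (at 0 within A)" and \<psi>0: "\<psi> 0 = 0"
    and half: "\<And>u. u \<in> U \<Longrightarrow> norm u < e \<Longrightarrow> \<psi> u = 2 *\<^sub>R \<psi> ((1/2) *\<^sub>R u)"
    and u: "u \<in> U" "norm u < e"
  shows "\<psi> u = D u"
proof (cases "u = 0")
  case True
  then show ?thesis using \<psi>0 linear_0[OF linD] by simp
next
  case False
  define h where "h n = (1 / 2 ^ n :: real)" for n
  have h: "h n > 0" "h n \<le> 1" for n by (simp_all add: h_def)
  have hu: "h n *\<^sub>R u \<in> U" "norm (h n *\<^sub>R u) < e" for n
    using u h[of n] subspace_scale[OF LS] mult_left_le_one_le[of "norm u" "h n"]
    by (auto simp: abs_of_pos)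
  have iter: "\<psi> u = inverse (h n) *\<^sub>R \<psi> (h n *\<^sub>R u)" for n
  proof (induction n)
    case (Suc n)
    show ?case using half[OF hu(1)[of n] hu(2)[of n]] Suc by (simp add: h_def mult.commute)
  qed (simp add: h_def)
  have lim: "h \<longlonglongrightarrow> 0"
    unfolding h_def using LIMSEQ_divide_realpow_zero[of 2 1] by simp
  have seq: "((\<lambda>n. h n *\<^sub>R u) \<longlonglongrightarrow> 0)"
    using tendsto_scaleR[OF lim tendsto_const[of u]] by simp
  have "filterlim (\<lambda>n. h n *\<^sub>R u) (at 0 within A) sequentially"
    unfolding filterlim_at
    using seq False h inA[OF hu] by (auto simp: eventually_sequentially)
      (metis less_irrefl)
  moreover have "((\<lambda>y. (1 / norm y) *\<^sub>R (\<psi> y - D y)) \<longlongrightarrow> 0) (at 0 within A)"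
    using \<psi>D[unfolded has_derivative_within] by (simp add: \<psi>0)
  ultimately have "(\<lambda>n. (1 / norm (h n *\<^sub>R u)) *\<^sub>R (\<psi> (h n *\<^sub>R u) - D (h n *\<^sub>R u))) \<longlonglongrightarrow> 0"
    by (rule filterlim_compose[rotated])
  moreover have "(1 / norm (h n *\<^sub>R u)) *\<^sub>R (\<psi> (h n *\<^sub>R u) - D (h n *\<^sub>R u)) =
      (1 / norm u) *\<^sub>R (\<psi> u - D u)" for n
  proof -
    have "h n *\<^sub>R \<psi> u = h n *\<^sub>R (inverse (h n) *\<^sub>R \<psi> (h n *\<^sub>R u))"
      using iter[of n] by (rule arg_cong)
    also have "\<dots> = \<psi> (h n *\<^sub>R u)" using h(1)[of n] by simp
    finally have "\<psi> (h n *\<^sub>R u) - D (h n *\<^sub>R u) = h n *\<^sub>R (\<psi> u - D u)"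
      by (simp add: linear_scale[OF linD] scaleR_diff_right)
    then show ?thesis using h(1)[of n] by simp
  qed
  ultimately have "(\<lambda>n::nat. (1 / norm u) *\<^sub>R (\<psi> u - D u)) \<longlonglongrightarrow> 0" by simp
  then have "(1 / norm u) *\<^sub>R (\<psi> u - D u) = 0"
    using LIMSEQ_unique tendsto_const by blast
  then show ?thesis using False by simp
qed

text \<open>
  A local lift of a homomorphism is additive near 0, because its failure to be additive is a small
  lattice vector.  It therefore equals its derivative there, and the linear map obtained lifts
  the homomorphism everywhere since every vector is a multiple of a small one.
\<close>

lemma morphism_linear_lift:
  assumes S: "complex_torus S" and T: "complex_torus T" and f: "morphism S T f"
  obtains F where "linear_lift S T f F"
proof -
  interpret S: group S by (rule torus_group[OF S])
  interpret T: group T by (rule torus_group[OF T])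
  have hom: "f \<in> hom S T" using f by (simp add: morphism_def)
  note LS = torus_Lie_subspace[OF S] and LT = torus_Lie_subspace[OF T]
  have 0: "0 \<in> Lie S" using LS by (rule subspace_0)
  have "\<exists>A \<phi>. openin (top_of_set (Lie S)) A \<and> 0 \<in> A \<and> \<phi> ` A \<subseteq> Lie T \<and>
        (\<forall>u \<in> A. f (expm S u) = expm T (\<phi> u)) \<and>
        (\<forall>u \<in> A. \<exists>D. Vector_Spaces.linear (*s) (*s) D \<and> (\<phi> has_derivative D) (at u within A))"
    using f 0 unfolding morphism_def torus_holomorphic_def by blast
  then obtain A \<phi> D where A: "openin (top_of_set (Lie S)) A" "0 \<in> A"
    and \<phi>T: "\<phi> ` A \<subseteq> Lie T" and \<phi>: "\<And>u. u \<in> A \<Longrightarrow> f (expm S u) = expm T (\<phi> u)"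
    and D: "Vector_Spaces.linear (*s) (*s) D" "(\<phi> has_derivative D) (at 0 within A)"
    by blast
  obtain e0 where e0: "e0 > 0" "ball 0 e0 \<inter> Lie S \<subseteq> A"
    using A unfolding openin_contains_ball by blast
  \<comment> \<open>\<open>\<phi> 0\<close> is a lattice vector, so subtracting it keeps a local lift and makes it vanish at 0.\<close>
  define \<psi> where "\<psi> u = \<phi> u - \<phi> 0" for u
  have f1: "f \<one>\<^bsub>S\<^esub> = \<one>\<^bsub>T\<^esub>" by (rule hom_one[OF hom]) unfold_locales
  have \<phi>0: "\<phi> 0 \<in> lattice T"
    using \<phi>[OF A(2)] \<phi>T A(2) f1 by (auto simp: lattice_def expm_zero[OF S])
  have \<psi>: "\<psi> u \<in> Lie T" "f (expm S u) = expm T (\<psi> u)" if "u \<in> A" for u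
  proof -
    have u: "\<phi> u \<in> Lie T" "\<phi> 0 \<in> Lie T" using \<phi>T that A(2) by auto
    then show 1: "\<psi> u \<in> Lie T" unfolding \<psi>_def by (rule subspace_diff[OF LT])
    have "expm T (\<phi> u) = expm T (\<psi> u)"
      using expm_eq_iff[OF T u(1) 1] \<phi>0 by (simp add: \<psi>_def)
    then show "f (expm S u) = expm T (\<psi> u)" using \<phi>[OF that] by simp
  qed
  have \<psi>0: "\<psi> 0 = 0" by (simp add: \<psi>_def)
  have \<psi>D: "(\<psi> has_derivative D) (at 0 within A)"
    unfolding \<psi>_def using D(2) by (auto intro!: derivative_eq_intros)
  then have cont: "continuous (at 0 within A) \<psi>" by (rule has_derivative_continuous)
  obtain d where d: "d > 0" "\<And>x y. x \<in> lattice T \<Longrightarrow> y \<in> lattice T \<Longrightarrow> dist x y < d \<Longrightarrow> x = y"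
    using lattice_uniform_discrete[OF T] unfolding uniform_discrete_def by blast
  \<comment> \<open>With values below a third of a lower bound \<open>d\<close> for lattice distances, the three terms of
    \<open>\<psi> u - (\<psi> w + \<psi> w)\<close> stay together below \<open>d\<close>.\<close>
  obtain e1 where e1: "e1 > 0" "\<And>u. u \<in> A \<Longrightarrow> norm u < e1 \<Longrightarrow> norm (\<psi> u) < d / 3"
  proof -
    have "\<exists>e>0. \<forall>x\<in>A. dist x 0 < e \<longrightarrow> dist (\<psi> x) (\<psi> 0) < d / 3"
      by (rule cont[unfolded continuous_within_eps_delta, rule_format]) (use d(1) in simp)
    then show thesis using that \<psi>0 by (auto simp: dist_norm)
  qed
  define e where "e = min e0 e1"
  have e: "e > 0" using e0 e1 by (simp add: e_def)
  have inA: "u \<in> A" if "u \<in> Lie S" "norm u < e" for u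
    using that e0(2) by (auto simp: e_def dist_norm)
  have small: "norm (\<psi> u) < d / 3" if "u \<in> Lie S" "norm u < e" for u
    using e1(2)[OF inA[OF that]] that by (simp add: e_def)
  have half: "\<psi> u = 2 *\<^sub>R \<psi> ((1/2) *\<^sub>R u)" if u: "u \<in> Lie S" "norm u < e" for u
  proof -
    define w where "w = (1/2::real) *\<^sub>R u"
    have w: "w \<in> Lie S" "norm w < e" "u = w + w"
      using u LS e by (auto simp: w_def subspace_scale)
    have "expm T (\<psi> u) = f (expm S w \<otimes>\<^bsub>S\<^esub> expm S w)"
      using \<psi>(2)[OF inA[OF u]] complex_torusD(4)[OF S w(1) w(1)] w(3) by simp
    also have "\<dots> = expm T (\<psi> w) \<otimes>\<^bsub>T\<^esub> expm T (\<psi> w)"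
      using hom_mult[OF hom expm_closed[OF S w(1)] expm_closed[OF S w(1)]]
        \<psi>(2)[OF inA[OF w(1,2)]] by simp
    also have "\<dots> = expm T (\<psi> w + \<psi> w)"
      by (rule complex_torusD(4)[OF T \<psi>(1)[OF inA[OF w(1,2)]] \<psi>(1)[OF inA[OF w(1,2)]], symmetric])
    finally have "\<psi> u - (\<psi> w + \<psi> w) \<in> lattice T"
      using expm_eq_iff[OF T] \<psi>(1)[OF inA[OF w(1,2)]] \<psi>(1)[OF inA[OF u]] subspace_add[OF LT]
      by blast
    moreover have "norm (\<psi> u - (\<psi> w + \<psi> w)) < d"
      using small[OF u] small[OF w(1,2)] norm_triangle_ineq4[of "\<psi> u" "\<psi> w + \<psi> w"]
        norm_triangle_ineq[of "\<psi> w" "\<psi> w"] by linarith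
    moreover have "0 \<in> lattice T"
      using lattice_additive_subgroup[OF T] by (simp add: additive_subgroup_def)
    ultimately have "\<psi> u - (\<psi> w + \<psi> w) = 0"
      by (intro d(2)) (simp_all only: dist_norm diff_zero)
    then show ?thesis by (simp add: w_def scaleR_2)
  qed
  have linD: "linear D" using D(1) by (rule complex_linear_imp_linear)
  have \<psi>_eq_D: "\<psi> u = D u" if "u \<in> Lie S" "norm u < e" for u
    by (rule halving_map_eq_derivative[OF LS inA linD \<psi>D \<psi>0 half that])
  have DT: "D v \<in> Lie T \<and> f (expm S v) = expm T (D v)" if v: "v \<in> Lie S" for v
  proof -
    obtain n :: nat where n: "norm v / e < real n" using reals_Archimedean2 by blast
    have n0: "n > 0" using n e by (cases n) (auto simp: field_simps)
    \<comment> \<open>The homomorphism property carries the lift from the small vector \<open>w\<close> to its multiples.\<close>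
    define w where "w = (1 / real n) *\<^sub>R v"
    have w: "w \<in> Lie S" "norm w < e" and vw: "v = real n *\<^sub>R w"
      using v subspace_scale[OF LS] n n0 e by (auto simp: w_def field_simps)
    have Dw: "D w \<in> Lie T" "f (expm S w) = expm T (D w)"
      using \<psi>_eq_D[OF w] \<psi>[OF inA[OF w]] by auto
    have "D (real k *\<^sub>R w) \<in> Lie T \<and> f (expm S (real k *\<^sub>R w)) = expm T (D (real k *\<^sub>R w))" for k
    proof (induction k)
      case 0
      then show ?case
        using f1 linear_0[OF linD] subspace_0[OF LT] by (simp add: expm_zero[OF S] expm_zero[OF T])
    next
      case (Suc k)
      have eq: "real (Suc k) *\<^sub>R w = w + real k *\<^sub>R w" by (simp add: scaleR_left_distrib)
      have kw: "real k *\<^sub>R w \<in> Lie S" using LS w(1) by (rule subspace_scale)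
      have "D (real (Suc k) *\<^sub>R w) \<in> Lie T"
        unfolding eq linear_add[OF linD] using Dw(1) Suc by (intro subspace_add[OF LT]) auto
      moreover have "f (expm S (real (Suc k) *\<^sub>R w)) = expm T (D (real (Suc k) *\<^sub>R w))"
        unfolding eq linear_add[OF linD] using Suc Dw complex_torusD(4)[OF S w(1) kw]
          complex_torusD(4)[OF T] hom_mult[OF hom expm_closed[OF S w(1)] expm_closed[OF S kw]]
        by simp
      ultimately show ?case by blast
    qed
    then show ?thesis unfolding vw by blast
  qed
  then have "linear_lift S T f D"
    using D(1) unfolding linear_lift_def by blast
  then show thesis by (rule that)
qed

section \<open>Subtori\<close>

lemma sub_torus_simps [simp]:
  "carrier (sub_torus T Z) = Z" "\<one>\<^bsub>sub_torus T Z\<^esub> = \<one>\<^bsub>T\<^esub>" "expm (sub_torus T Z) = expm T"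
  "x \<otimes>\<^bsub>sub_torus T Z\<^esub> y = x \<otimes>\<^bsub>T\<^esub> y"
  by (simp_all add: sub_torus_def)

lemma Lie_sub_torus:
  "Lie (sub_torus T Z) = {v \<in> Lie T. \<forall>t::real. expm T (t *\<^sub>R v) \<in> Z}"
  by (simp add: sub_torus_def)

lemma lattice_sub_torus: "lattice (sub_torus T Z) = lattice T \<inter> Lie (sub_torus T Z)"
  by (auto simp: lattice_def Lie_sub_torus)

lemma expm_image_subgroup:
  assumes T: "complex_torus T" and U: "subspace U" "U \<subseteq> Lie T"
  shows "subgroup (expm T ` U) T"
proof -
  interpret group T by (rule torus_group[OF T])
  show ?thesis
  proof (rule subgroupI)
    show "expm T ` U \<subseteq> carrier T" using U(2) expm_closed[OF T] by blast
    show "expm T ` U \<noteq> {}" using subspace_0[OF U(1)] by blast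
  next
    fix a assume "a \<in> expm T ` U"
    then obtain u where "u \<in> U" "a = expm T u" by blast
    then show "inv\<^bsub>T\<^esub> a \<in> expm T ` U"
      using expm_uminus[OF T, of u] U subspace_neg[OF U(1)] by (metis image_eqI subsetD)
  next
    fix a b assume "a \<in> expm T ` U" "b \<in> expm T ` U"
    then obtain u v where "u \<in> U" "a = expm T u" "v \<in> U" "b = expm T v" by blast
    then show "a \<otimes>\<^bsub>T\<^esub> b \<in> expm T ` U"
      using complex_torusD(4)[OF T, of u v] U subspace_add[OF U(1)] by (metis image_eqI subsetD)
  qed
qed

text \<open>
  The subspace is recovered from its set of points, so that subtori can be compared through their
  tangent spaces.
\<close>

lemma Lie_sub_torus_expm_image:
  assumes T: "complex_torus T" and U: "subspace U" "U \<subseteq> Lie T"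
  shows "Lie (sub_torus T (expm T ` U)) = U"
proof
  show "Lie (sub_torus T (expm T ` U)) \<subseteq> U"
    using line_in_subspace_mod_lattice[OF T U] by (auto simp: Lie_sub_torus)
  show "U \<subseteq> Lie (sub_torus T (expm T ` U))"
    using U subspace_scale[OF U(1)] by (auto simp: Lie_sub_torus)
qed

lemma comm_group_sub_torus:
  assumes T: "comm_group T" and Z: "subgroup Z T"
  shows "comm_group (sub_torus T Z)"
proof -
  interpret comm_group T by fact
  interpret subgroup Z T by fact
  show ?thesis
  proof (rule comm_groupI)
    fix x assume "x \<in> carrier (sub_torus T Z)"
    then show "\<exists>y \<in> carrier (sub_torus T Z). y \<otimes>\<^bsub>sub_torus T Z\<^esub> x = \<one>\<^bsub>sub_torus T Z\<^esub>"
      by (intro bexI[of _ "inv\<^bsub>T\<^esub> x"]) simp_all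
  qed (simp_all add: m_ac)
qed

lemma complex_torus_sub_torus:
  assumes T: "complex_torus T" and U: "vec.subspace U" "U \<subseteq> Lie T"
    and sp: "U \<subseteq> span (lattice T \<inter> U)"
  shows "complex_torus (sub_torus T (expm T ` U))"
proof -
  have U': "subspace U" using U(1) by (rule complex_subspace_imp_subspace)
  note L = Lie_sub_torus_expm_image[OF T U' U(2)]
  have "span (lattice T \<inter> U) \<subseteq> U" using U' by (intro span_minimal) auto
  moreover have "discrete (lattice T \<inter> U)"
    using discrete_subset[OF complex_torusD(5)[OF T]] by blast
  ultimately show ?thesis
    unfolding complex_torus_def lattice_sub_torus L
    using comm_group_sub_torus[OF complex_torusD(1)[OF T] expm_image_subgroup[OF T U' U(2)]]
      sp U(1) complex_torusD(4)[OF T] subsetD[OF U(2)] by auto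
qed

lemma abelian_subvarietyD:
  assumes "abelian_subvariety T Z"
  shows "subgroup Z T" "complex_torus (sub_torus T Z)" "vec.subspace (Lie (sub_torus T Z))"
    "Lie (sub_torus T Z) \<subseteq> Lie T" "expm T ` Lie (sub_torus T Z) = Z"
proof -
  show *: "subgroup Z T" "complex_torus (sub_torus T Z)"
    using assms by (simp_all add: abelian_subvariety_def abelian_variety_def)
  show "vec.subspace (Lie (sub_torus T Z))" "expm T ` Lie (sub_torus T Z) = Z"
    using complex_torusD(2,3)[OF *(2)] by simp_all
  show "Lie (sub_torus T Z) \<subseteq> Lie T" by (auto simp: Lie_sub_torus)
qed

lemma linear_id: "Vector_Spaces.linear (*s) (*s) (\<lambda>v :: complex ^ 'n. v)"
  by unfold_locales (simp_all add: vec.scale_right_distrib vec.scale_left_distrib)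

lemma linear_lift_inclusion: "linear_lift (sub_torus T Z) T (\<lambda>x. x) (\<lambda>v. v)"
  using linear_id by (auto simp: linear_lift_def Lie_sub_torus)

section \<open>Isogenies\<close>

text \<open>
  A torus is covered by a bounded part of its tangent space.  If the lift of a homomorphism is
  injective, the points of this part that represent the kernel correspond to lattice vectors in
  a bounded set.
\<close>

lemma linear_lift_finite_kernel:
  assumes T: "complex_torus T" and S: "subspace (Lie S)"
    and D: "bounded D" "D \<subseteq> Lie S" "carrier S \<subseteq> expm S ` D"
    and F: "linear_lift S T f F" and inj: "\<And>v. v \<in> Lie S \<Longrightarrow> F v = 0 \<Longrightarrow> v = 0"
  shows "finite (kernel S T f)"
proof -
  have lin: "linear F" using F by (simp add: linear_lift_def complex_linear_imp_linear)
  have "inj_on F D"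
  proof (rule inj_onI)
    fix x y assume xy: "x \<in> D" "y \<in> D" "F x = F y"
    then have "F (x - y) = 0" using linear_diff[OF lin] by simp
    moreover have "x - y \<in> Lie S" using xy D(2) subspace_diff[OF S] by blast
    ultimately show "x = y" using inj by fastforce
  qed
  moreover have "bounded (F ` D)"
    using D(1) lin by (simp add: bounded_linear_image linear_conv_bounded_linear)
  then have "finite (lattice T \<inter> F ` D)"
    by (rule uniform_discrete_bounded_finite[OF lattice_uniform_discrete[OF T]])
  ultimately have "finite (F -` (lattice T \<inter> F ` D) \<inter> D)"
    by (intro finite_vimage_IntI)
  moreover have "kernel S T f \<subseteq> expm S ` (F -` (lattice T \<inter> F ` D) \<inter> D)"
  proof
    fix p assume "p \<in> kernel S T f"
    then have p: "p \<in> carrier S" "f p = \<one>\<^bsub>T\<^esub>" by (simp_all add: kernel_def)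
    then obtain v where v: "v \<in> D" "p = expm S v" using D(3) by blast
    then have "F v \<in> lattice T" using F p(2) D(2) unfolding linear_lift_def lattice_def by auto
    then show "p \<in> expm S ` (F -` (lattice T \<inter> F ` D) \<inter> D)" using v by blast
  qed
  ultimately show ?thesis by (meson finite_imageI finite_subset)
qed

lemma linear_lift_isogeny:
  assumes T: "complex_torus T" and S: "subspace (Lie S)"
    and D: "bounded D" "D \<subseteq> Lie S" "carrier S \<subseteq> expm S ` D"
    and hom: "f \<in> hom S T" and onto: "f ` carrier S = carrier T"
    and F: "linear_lift S T f F" and inj: "\<And>v. v \<in> Lie S \<Longrightarrow> F v = 0 \<Longrightarrow> v = 0"
  shows "isogeny S T f"
  using linear_lift_finite_kernel[OF T S D F inj] linear_lift_holomorphic[OF F] hom onto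
  by (simp add: isogeny_def morphism_def)

section \<open>Products of tori\<close>

lemma vpair_nth [simp]: "vpair x y $ Inl i = x $ i" "vpair x y $ Inr j = y $ j"
  by (simp_all add: vpair_def)

lemma vfst_vpair [simp]: "vfst (vpair x y) = x" and vsnd_vpair [simp]: "vsnd (vpair x y) = y"
  by (simp_all add: vfst_def vsnd_def vec_eq_iff)

lemma vpair_vfst_vsnd: "vpair (vfst z) (vsnd z) = z"
proof -
  have "vpair (vfst z) (vsnd z) $ i = z $ i" for i
    by (cases i) (simp_all add: vfst_def vsnd_def)
  then show ?thesis by (simp add: vec_eq_iff)
qed

lemma vec_sum_eqI: "vfst z = vfst w \<Longrightarrow> vsnd z = vsnd w \<Longrightarrow> z = w"
  by (metis vpair_vfst_vsnd)

lemma vfst_simps [simp]: "vfst (z + w) = vfst z + vfst w" "vfst (c *s z) = c *s vfst z"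
    "vfst (r *\<^sub>R z) = r *\<^sub>R vfst z" "vfst 0 = 0"
  and vsnd_simps [simp]: "vsnd (z + w) = vsnd z + vsnd w" "vsnd (c *s z) = c *s vsnd z"
    "vsnd (r *\<^sub>R z) = r *\<^sub>R vsnd z" "vsnd 0 = 0"
  by (simp_all add: vfst_def vsnd_def vec_eq_iff)

lemma linear_vfst: "Vector_Spaces.linear (*s) (*s) vfst"
  and linear_vsnd: "Vector_Spaces.linear (*s) (*s) vsnd"
  by (unfold_locales; simp add: vec.scale_right_distrib vec.scale_left_distrib)+

lemma linear_vfst_plus_vsnd:
  "Vector_Spaces.linear (*s) (*s) (\<lambda>z :: complex ^ ('n::finite + 'n). vfst z + vsnd z)"
  by unfold_locales (simp_all add: vec.scale_right_distrib vec.scale_left_distrib)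

lemma linear_vpair: "linear (\<lambda>p. vpair (fst p) (snd p))"
  by (rule linearI) (auto intro!: vec_sum_eqI)

lemma prod_torus_simps [simp]:
  "carrier (prod_torus S T) = carrier S \<times> carrier T"
  "(x, y) \<otimes>\<^bsub>prod_torus S T\<^esub> (x', y') = (x \<otimes>\<^bsub>S\<^esub> x', y \<otimes>\<^bsub>T\<^esub> y')"
  "\<one>\<^bsub>prod_torus S T\<^esub> = (\<one>\<^bsub>S\<^esub>, \<one>\<^bsub>T\<^esub>)"
  "expm (prod_torus S T) z = (expm S (vfst z), expm T (vsnd z))"
  by (simp_all add: prod_torus_def)

lemma Lie_prod_torus: "Lie (prod_torus S T) = {z. vfst z \<in> Lie S \<and> vsnd z \<in> Lie T}"
proof -
  have "z \<in> {vpair u v | u v. u \<in> Lie S \<and> v \<in> Lie T} \<longleftrightarrow> vfst z \<in> Lie S \<and> vsnd z \<in> Lie T" for z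
    using vpair_vfst_vsnd[of z, symmetric] by fastforce
  then show ?thesis by (simp add: prod_torus_def)
qed

lemma lattice_prod_torus:
  "lattice (prod_torus S T) = {z. vfst z \<in> lattice S \<and> vsnd z \<in> lattice T}"
  by (auto simp: lattice_def Lie_prod_torus)

lemma prod_torus_Lie_subspace:
  "subspace (Lie S) \<Longrightarrow> subspace (Lie T) \<Longrightarrow> subspace (Lie (prod_torus S T))"
  unfolding Lie_prod_torus by (simp add: subspace_def)

text \<open>
  Products enter only as sources of homomorphisms, for which a bounded domain and the tangent space
  carry all the information that isogenies require.
\<close>

lemma prod_torus_bounded_domain:
  assumes "complex_torus S" "complex_torus T"
  obtains D where "bounded D" "D \<subseteq> Lie (prod_torus S T)"
    "carrier (prod_torus S T) \<subseteq> expm (prod_torus S T) ` D"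
proof -
  obtain D1 where D1: "bounded D1" "D1 \<subseteq> Lie S" "expm S ` D1 = carrier S"
    using torus_bounded_domain[OF assms(1)] .
  obtain D2 where D2: "bounded D2" "D2 \<subseteq> Lie T" "expm T ` D2 = carrier T"
    using torus_bounded_domain[OF assms(2)] .
  define D where "D = (\<lambda>p. vpair (fst p) (snd p)) ` (D1 \<times> D2)"
  have "bounded D"
    unfolding D_def using linear_vpair D1(1) D2(1)
    by (intro bounded_linear_image bounded_Times) (simp_all add: linear_conv_bounded_linear)
  moreover have "D \<subseteq> Lie (prod_torus S T)"
    using D1(2) D2(2) by (auto simp: D_def Lie_prod_torus)
  moreover have "carrier (prod_torus S T) \<subseteq> expm (prod_torus S T) ` D"
  proof
    fix p assume "p \<in> carrier (prod_torus S T)"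
    then have "p \<in> expm S ` D1 \<times> expm T ` D2" by (simp add: D1(3) D2(3))
    then obtain u v where "u \<in> D1" "v \<in> D2" "p = (expm S u, expm T v)" by auto
    moreover from this have "vpair u v \<in> D" by (force simp: D_def)
    ultimately show "p \<in> expm (prod_torus S T) ` D"
      by (intro image_eqI[of _ _ "vpair u v"]) simp_all
  qed
  ultimately show thesis by (rule that)
qed

lemma linear_lift_fst: "linear_lift (prod_torus S T) S fst vfst"
  and linear_lift_snd: "linear_lift (prod_torus S T) T snd vsnd"
  using linear_vfst linear_vsnd by (auto simp: linear_lift_def Lie_prod_torus)

lemma linear_lift_sum_map:
  fixes T :: "('p, 'n::finite) ctorus"
  assumes T: "complex_torus T"
  shows "linear_lift (prod_torus (sub_torus T X) (sub_torus T X')) T (sum_map T) (\<lambda>z. vfst z + vsnd z)"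
  using linear_vfst_plus_vsnd subspace_add[OF torus_Lie_subspace[OF T]] complex_torusD(4)[OF T]
  by (auto simp: linear_lift_def Lie_prod_torus Lie_sub_torus sum_map_def)

lemma sum_map_hom:
  assumes T: "complex_torus T" and X: "subgroup X T" "subgroup X' T"
  shows "sum_map T \<in> hom (prod_torus (sub_torus T X) (sub_torus T X')) T"
proof -
  interpret comm_group T by (rule complex_torusD(1)[OF T])
  have "a \<in> carrier T" if "a \<in> X \<or> a \<in> X'" for a
    using that subgroup.mem_carrier[OF X(1)] subgroup.mem_carrier[OF X(2)] by blast
  then show ?thesis
    by (auto simp: hom_def sum_map_def m_ac)
qed

section \<open>First Chern classes\<close>

text \<open>
  The logarithms among which \<open>bundle_log\<close> chooses.  Their existence is stable under pullbacks and
  tensor products and suffices to compute Chern classes, so these computations can stay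
  topological.
\<close>

definition continuous_log :: "('p, 'n::finite) ctorus \<Rightarrow> 'n factor \<Rightarrow> complex ^ 'n \<Rightarrow>
    (complex ^ 'n \<Rightarrow> complex) \<Rightarrow> bool" where
  "continuous_log T L l g \<longleftrightarrow> continuous_on (Lie T) g \<and>
     (\<forall>v \<in> Lie T. L l v = exp (2 * complex_of_real pi * \<i> * g v))"

definition has_logs :: "('p, 'n::finite) ctorus \<Rightarrow> 'n factor \<Rightarrow> bool" where
  "has_logs T L \<longleftrightarrow> (\<forall>l \<in> lattice T. \<exists>g. continuous_log T L l g)"

lemma bundle_log_continuous_log:
  assumes "continuous_log T L l g"
  shows "continuous_log T L l (bundle_log T L l)"
proof -
  have "bundle_log T L l = (SOME g. continuous_log T L l g)"
    unfolding bundle_log_def continuous_log_def ..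
  then show ?thesis using someI[of "continuous_log T L l", OF assms] by simp
qed

lemma has_logsD:
  "has_logs T L \<Longrightarrow> l \<in> lattice T \<Longrightarrow> continuous_log T L l (bundle_log T L l)"
  unfolding has_logs_def using bundle_log_continuous_log by blast

lemma exp_two_pi_i_eq_iff:
  "exp (2 * complex_of_real pi * \<i> * a) = exp (2 * complex_of_real pi * \<i> * b) \<longleftrightarrow> a - b \<in> \<int>"
proof -
  have "exp (2 * complex_of_real pi * \<i> * a) = exp (2 * complex_of_real pi * \<i> * b) \<longleftrightarrow>
      (\<exists>n::int. 2 * complex_of_real pi * \<i> * a =
        2 * complex_of_real pi * \<i> * b + (of_int (2 * n) * pi) * \<i>)"
    by (rule exp_eq)
  also have "\<dots> \<longleftrightarrow> (\<exists>n::int. a - b = of_int n)"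
  proof (rule ex_cong1)
    fix n :: int
    have "2 * complex_of_real pi * \<i> * a = 2 * complex_of_real pi * \<i> * b + (of_int (2 * n) * pi) * \<i>
        \<longleftrightarrow> (2 * complex_of_real pi * \<i>) * (a - b) = (2 * complex_of_real pi * \<i>) * of_int n"
      by (simp add: algebra_simps)
    also have "\<dots> \<longleftrightarrow> a - b = of_int n" by simp
    finally show "2 * complex_of_real pi * \<i> * a = 2 * complex_of_real pi * \<i> * b + (of_int (2 * n) * pi) * \<i>
        \<longleftrightarrow> a - b = of_int n" .
  qed
  finally show ?thesis by (auto simp: Ints_def)
qed

text \<open>
  The difference of two logarithms is continuous and integral on a connected set, hence constant.
\<close>

lemma continuous_log_unique:
  assumes S: "subspace (Lie T)" and g: "continuous_log T L l g" "continuous_log T L l h"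
    and uv: "u \<in> Lie T" "v \<in> Lie T"
  shows "g u - h u = g v - h v"
proof -
  have int: "g w - h w \<in> \<int>" if "w \<in> Lie T" for w
    using g that unfolding continuous_log_def by (simp add: exp_two_pi_i_eq_iff[symmetric])
  have "(\<lambda>w. g w - h w) constant_on Lie T"
  proof (rule continuous_discrete_range_constant)
    show "connected (Lie T)" using S by (simp add: convex_connected subspace_imp_convex)
    show "continuous_on (Lie T) (\<lambda>w. g w - h w)"
      using g by (auto simp: continuous_log_def intro: continuous_intros)
  next
    fix x assume x: "x \<in> Lie T"
    have "1 \<le> norm ((g y - h y) - (g x - h x))"
      if "y \<in> Lie T" "g y - h y \<noteq> g x - h x" for y
    proof -
      have "(g y - h y) - (g x - h x) \<in> \<int>" using int[OF x] int[OF that(1)] by (rule Ints_diff[rotated])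
      then obtain n :: int where n: "(g y - h y) - (g x - h x) = of_int n" by (elim Ints_cases)
      then have "n \<noteq> 0" using that(2) by auto
      then show ?thesis unfolding n by (simp add: norm_of_int)
    qed
    then show "\<exists>e>0. \<forall>y. y \<in> Lie T \<and> g y - h y \<noteq> g x - h x \<longrightarrow>
        e \<le> norm ((g y - h y) - (g x - h x))"
      by (intro exI[of _ 1]) simp
  qed
  then show ?thesis using uv unfolding constant_on_def by metis
qed

text \<open>Any logarithms compute the Chern class: the integers by which two choices differ cancel.\<close>

lemma chern_class_eq:
  assumes S: "subspace (Lie T)" and lm: "l \<in> Lie T" "m \<in> Lie T"
    and g: "continuous_log T L l g" and h: "continuous_log T L m h"
  shows "chern_class T L l m = h l + g 0 - g m - h 0"
proof -
  note bl = bundle_log_continuous_log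
  have "bundle_log T L m l - h l = bundle_log T L m 0 - h 0"
    by (rule continuous_log_unique[OF S bl[OF h] h lm(1) subspace_0[OF S]])
  moreover have "bundle_log T L l 0 - g 0 = bundle_log T L l m - g m"
    by (rule continuous_log_unique[OF S bl[OF g] g subspace_0[OF S] lm(2)])
  ultimately show ?thesis
    unfolding chern_class_def by (simp add: algebra_simps)
qed

lemma line_bundle_has_logs:
  assumes S: "subspace (Lie T)" and L: "line_bundle T L"
  shows "has_logs T L"
  unfolding has_logs_def
proof
  fix l assume l: "l \<in> lattice T"
  have "continuous_on (Lie T) (L l)"
    unfolding continuous_on_eq_continuous_within
  proof
    fix v assume "v \<in> Lie T"
    then obtain D where "(L l has_derivative D) (at v within Lie T)"
      using L l unfolding line_bundle_def by blast
    then show "continuous (at v within Lie T) (L l)" by (rule has_derivative_continuous)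
  qed
  moreover have "contractible (Lie T)"
    using S by (simp add: convex_imp_contractible subspace_imp_convex)
  moreover have "L l v \<noteq> 0" if "v \<in> Lie T" for v
    using L l that unfolding line_bundle_def by blast
  ultimately obtain g where g: "continuous_on (Lie T) g" "\<And>v. v \<in> Lie T \<Longrightarrow> L l v = exp (g v)"
    using continuous_logarithm_on_contractible by metis
  have "continuous_log T L l (\<lambda>v. g v / (2 * complex_of_real pi * \<i>))"
    using g by (auto simp: continuous_log_def intro!: continuous_intros)
  then show "\<exists>g. continuous_log T L l g" by blast
qed

text \<open>
  The cocycle condition computes \<open>L (l + m) 0\<close> in two ways, \<open>L m l * L l 0\<close> and \<open>L l m * L m 0\<close>;
  the logarithms of the two products differ by the Chern class, which is therefore an integer.
\<close>

lemma chern_class_integral: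
  assumes S: "complex_torus T" and L: "line_bundle T L" and lm: "l \<in> lattice T" "m \<in> lattice T"
  shows "chern_class T L l m \<in> \<int>"
proof -
  note LS = torus_Lie_subspace[OF S]
  have L0: "0 \<in> Lie T" using LS by (rule subspace_0)
  define c where "c = 2 * complex_of_real pi * \<i>"
  define g where "g = bundle_log T L l"
  define h where "h = bundle_log T L m"
  have g: "L l v = exp (c * g v)" and h: "L m v = exp (c * h v)" if "v \<in> Lie T" for v
    using has_logsD[OF line_bundle_has_logs[OF LS L]] lm that
    unfolding continuous_log_def c_def g_def h_def by blast+
  have coc: "L (l + m) v = L l (v + m) * L m v" if "l \<in> lattice T" "m \<in> lattice T" "v \<in> Lie T" for l m v
    using L that unfolding line_bundle_def by blast
  have "L m l * L l 0 = L l m * L m 0"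
    using coc[OF lm L0] coc[OF lm(2,1) L0] by (simp add: add.commute)
  then have "exp (c * (h l + g 0)) = exp (c * (g m + h 0))"
    using g[OF subsetD[OF lattice_subset_Lie lm(2)]] g[OF L0]
      h[OF subsetD[OF lattice_subset_Lie lm(1)]] h[OF L0]
    by (simp add: distrib_left exp_add)
  then have "(h l + g 0) - (g m + h 0) \<in> \<int>"
    unfolding c_def exp_two_pi_i_eq_iff .
  then show ?thesis unfolding chern_class_def g_def h_def by (simp add: algebra_simps)
qed

lemma continuous_log_pullback:
  assumes T: "complex_torus T" and S: "subspace (Lie S)" and F: "linear_lift S T f F"
    and l: "l \<in> Lie S" and g: "continuous_log T L (F l) g"
  shows "continuous_log S (pullback S T f L) l (g \<circ> F)"
proof -
  note rep = linear_lift_analytic_rep[OF T S F]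
  have "linear F" using F by (simp add: linear_lift_def complex_linear_imp_linear)
  then have lin: "bounded_linear F" by (simp add: linear_conv_bounded_linear)
  have FT: "F ` Lie S \<subseteq> Lie T" using F by (simp add: linear_lift_def)
  have "continuous_on (Lie S) (g \<circ> F)"
    using g FT by (intro continuous_on_compose[OF linear_continuous_on[OF lin]])
      (auto simp: continuous_log_def intro: continuous_on_subset)
  then show ?thesis
    using g FT rep(2) l unfolding continuous_log_def pullback_def by auto
qed

lemma has_logs_pullback:
  assumes T: "complex_torus T" and S: "subspace (Lie S)" and F: "linear_lift S T f F"
    and lat: "F ` lattice S \<subseteq> lattice T" and L: "has_logs T L"
  shows "has_logs S (pullback S T f L)"
  unfolding has_logs_def
proof
  fix l assume l: "l \<in> lattice S"
  then show "\<exists>g. continuous_log S (pullback S T f L) l g"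
    using continuous_log_pullback[OF T S F _ has_logsD[OF L]] lat lattice_subset_Lie by blast
qed

lemma chern_class_pullback:
  assumes T: "complex_torus T" and S: "subspace (Lie S)" and F: "linear_lift S T f F"
    and lat: "F ` lattice S \<subseteq> lattice T" and L: "has_logs T L"
    and lm: "l \<in> lattice S" "m \<in> lattice S"
  shows "chern_class S (pullback S T f L) l m = chern_class T L (F l) (F m)"
proof -
  have lm': "l \<in> Lie S" "m \<in> Lie S" using lm lattice_subset_Lie by blast+
  have F0: "F 0 = 0" using F by (simp add: linear_lift_def complex_linear_imp_linear linear_0)
  have logs: "continuous_log T L (F l) (bundle_log T L (F l))"
      "continuous_log T L (F m) (bundle_log T L (F m))"
    using has_logsD[OF L] lat lm by blast+
  show ?thesis
    using chern_class_eq[OF S lm' continuous_log_pullback[OF T S F lm'(1) logs(1)]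
        continuous_log_pullback[OF T S F lm'(2) logs(2)]] F0
    by (simp add: chern_class_def)
qed

lemma chern_class_tensor:
  assumes S: "subspace (Lie T)" and L: "has_logs T L" "has_logs T M"
    and lm: "l \<in> lattice T" "m \<in> lattice T"
  shows "chern_class T (tensor L M) l m = chern_class T L l m + chern_class T M l m"
proof -
  have log: "continuous_log T (tensor L M) k (\<lambda>v. bundle_log T L k v + bundle_log T M k v)"
    if "k \<in> lattice T" for k
    using has_logsD[OF L(1) that] has_logsD[OF L(2) that]
    unfolding continuous_log_def tensor_def
    by (auto intro!: continuous_intros simp: distrib_left exp_add)
  have lm': "l \<in> Lie T" "m \<in> Lie T" using lm lattice_subset_Lie by blast+
  show ?thesis
    using chern_class_eq[OF S lm' log[OF lm(1)] log[OF lm(2)]]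
    by (simp add: chern_class_def)
qed

lemma lattice_sub_torus_subset: "(\<lambda>v. v) ` lattice (sub_torus T Z) \<subseteq> lattice T"
  by (auto simp: lattice_sub_torus)

section \<open>Positive definite Hermitian forms\<close>

definition positive_on :: "(complex ^ 'n::finite) set \<Rightarrow> 'n factor \<Rightarrow> bool" where
  "positive_on A H \<longleftrightarrow> vec.subspace A \<and> hermitian_on A H \<and> (\<forall>x \<in> A. x \<noteq> 0 \<longrightarrow> Re (H x x) > 0)"

definition orth :: "(complex ^ 'n::finite) set \<Rightarrow> 'n factor \<Rightarrow> (complex ^ 'n) set \<Rightarrow> (complex ^ 'n) set"
  where "orth A H U = {v \<in> A. \<forall>u \<in> U. H u v = 0}"

lemma positive_onD:
  assumes "positive_on A H"
  shows "vec.subspace A"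
    "\<And>x y z. x \<in> A \<Longrightarrow> y \<in> A \<Longrightarrow> z \<in> A \<Longrightarrow> H (x + y) z = H x z + H y z"
    "\<And>c x y. x \<in> A \<Longrightarrow> y \<in> A \<Longrightarrow> H (c *s x) y = c * H x y"
    "\<And>x y. x \<in> A \<Longrightarrow> y \<in> A \<Longrightarrow> H y x = cnj (H x y)"
    "\<And>x. x \<in> A \<Longrightarrow> H x x = 0 \<Longrightarrow> x = 0"
proof -
  show "vec.subspace A"
    "\<And>x y z. x \<in> A \<Longrightarrow> y \<in> A \<Longrightarrow> z \<in> A \<Longrightarrow> H (x + y) z = H x z + H y z"
    "\<And>c x y. x \<in> A \<Longrightarrow> y \<in> A \<Longrightarrow> H (c *s x) y = c * H x y"
    "\<And>x y. x \<in> A \<Longrightarrow> y \<in> A \<Longrightarrow> H y x = cnj (H x y)"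
    using assms unfolding positive_on_def hermitian_on_def by blast+
  fix x assume "x \<in> A" "H x x = 0"
  then show "x = 0" using assms unfolding positive_on_def by (metis less_irrefl zero_complex.simps(1))
qed

lemma positive_on_right:
  assumes H: "positive_on A H" and "x \<in> A" "y \<in> A" "z \<in> A"
  shows "H x (y + z) = H x y + H x z" and "H x (c *s y) = cnj c * H x y"
proof -
  have A: "y + z \<in> A" "c *s y \<in> A"
    using positive_onD(1)[OF H] assms by (auto intro: vec.subspace_add vec.subspace_scale)
  show "H x (y + z) = H x y + H x z"
    using positive_onD(4)[OF H, of _ x] positive_onD(2)[OF H, of y z x] assms A by simp
  show "H x (c *s y) = cnj c * H x y"
    using positive_onD(4)[OF H, of _ x] positive_onD(3)[OF H, of y x c] assms A by simp
qed

lemma real_linear_on_Im_form: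
  assumes H: "positive_on A H" and x: "x \<in> A"
  shows "real_linear_on A (\<lambda>y. Im (H x y))"
  using positive_on_right[OF H x] by (simp add: real_linear_on_def scaleR_eq_smult)

lemma orth_subspace:
  assumes H: "positive_on A H" and U: "U \<subseteq> A"
  shows "vec.subspace (orth A H U)"
proof -
  note A = positive_onD(1)[OF H]
  have "H u 0 = 0" if "u \<in> U" for u
    using positive_on_right(2)[OF H, of u 0 0 0] that U vec.subspace_0[OF A] by auto
  then have "0 \<in> orth A H U" using vec.subspace_0[OF A] by (simp add: orth_def)
  moreover have "x + y \<in> orth A H U" if "x \<in> orth A H U" "y \<in> orth A H U" for x y
    using that U positive_on_right(1)[OF H, of _ x y] vec.subspace_add[OF A, of x y]
    by (simp add: orth_def subset_iff)
  moreover have "c *s x \<in> orth A H U" if "x \<in> orth A H U" for c x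
    using that U positive_on_right(2)[OF H, of _ x x c] vec.subspace_scale[OF A, of x c]
    by (simp add: orth_def subset_iff)
  ultimately show ?thesis by (rule vec.subspaceI)
qed

text \<open>
  Since \<open>Im (H (\<i> *s u) v) = Re (H u v)\<close>, the alternating form alone detects orthogonality to a
  complex subspace.
\<close>

lemma in_orth_if_Im_zero:
  assumes H: "positive_on A H" and U: "vec.subspace U" "U \<subseteq> A" and v: "v \<in> A"
    and Im: "\<And>u. u \<in> U \<Longrightarrow> Im (H u v) = 0"
  shows "v \<in> orth A H U"
proof -
  have "H u v = 0" if u: "u \<in> U" for u
  proof -
    have "Im (H (\<i> *s u) v) = 0" using Im vec.subspace_scale[OF U(1) u] by blast
    then have "Re (H u v) = 0" using positive_onD(3)[OF H, of u v \<i>] u U(2) v by auto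
    then show ?thesis using Im[OF u] by (simp add: complex_eq_iff)
  qed
  then show ?thesis using v by (simp add: orth_def)
qed

lemma form_vanishes_on_span:
  assumes H: "positive_on A H" and B: "B \<subseteq> A" and v: "v \<in> A"
    and zero: "\<And>b. b \<in> B \<Longrightarrow> H b v = 0" and u: "u \<in> vec.span B"
  shows "H u v = 0"
proof -
  note A = positive_onD(1)[OF H]
  have "H 0 v = 0" using positive_onD(3)[OF H v v, of 0] by simp
  then have "vec.subspace {u \<in> A. H u v = 0}"
    using A positive_onD(2,3)[OF H] v by (simp add: vec.subspace_def)
  then have "vec.span B \<subseteq> {u \<in> A. H u v = 0}"
    using B zero by (intro vec.span_minimal) auto
  then show ?thesis using u by blast
qed

text \<open>
  Gram-Schmidt orthogonalization: the projection to the span of \<open>B\<close> is corrected along \<open>b'\<close>, the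
  component of \<open>b\<close> orthogonal to \<open>B\<close>.
\<close>

lemma orthogonal_projection_exists:
  assumes H: "positive_on A H" and B: "finite B" "B \<subseteq> A"
  shows "\<forall>x \<in> A. \<exists>u \<in> vec.span B. \<forall>b \<in> B. H b (x - u) = 0"
  using B
proof (induction B)
  case empty
  then show ?case by auto
next
  case (insert b B)
  note A = positive_onD(1)[OF H]
  have bA: "b \<in> A" and BA: "B \<subseteq> A" using insert.prems by auto
  have spA: "vec.span B \<subseteq> A" using A BA by (intro vec.span_minimal)
  have mono: "vec.span B \<subseteq> vec.span (insert b B)" by (intro vec.span_mono) auto
  obtain u0 where u0: "u0 \<in> vec.span B" "\<forall>c \<in> B. H c (b - u0) = 0"
    using insert.IH[OF BA] bA by blast
  define b' where "b' = b - u0"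
  have b'A: "b' \<in> A" using bA u0(1) spA A by (auto simp: b'_def intro: vec.subspace_diff)
  have b'_span: "b' \<in> vec.span (insert b B)"
    using u0(1) mono unfolding b'_def by (intro vec.span_diff) (auto intro: vec.span_base)
  show ?case
  proof
    fix x assume x: "x \<in> A"
    obtain u1 where u1: "u1 \<in> vec.span B" "\<forall>c \<in> B. H c (x - u1) = 0"
      using insert.IH[OF BA] x by blast
    have xu1: "x - u1 \<in> A" using x u1(1) spA A by (auto intro: vec.subspace_diff)
    \<comment> \<open>If \<open>b' = 0\<close>, then \<open>b\<close> already lies in the span of \<open>B\<close>; \<open>k\<close> is then 0 by the convention for
      division, which is harmless.\<close>
    define k where "k = H (x - u1) b' / H b' b'"
    have kb': "k *s b' \<in> A" using A b'A by (rule vec.subspace_scale)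
    define u where "u = u1 + k *s b'"
    have xu: "x - u = (x - u1) + (- k) *s b'"
      by (simp add: u_def vec.scale_left_distrib vec_eq_iff)
    have xuA: "x - u \<in> A"
      unfolding xu using A xu1 b'A by (intro vec.subspace_add vec.subspace_scale)
    have expand: "H c (x - u) = H c (x - u1) + cnj (- k) * H c b'" if "c \<in> A" for c
    proof -
      have "(- k) *s b' \<in> A" using A b'A by (rule vec.subspace_scale)
      then show ?thesis
        unfolding xu using positive_on_right(1)[OF H that xu1] positive_on_right(2)[OF H that b'A b'A]
        by metis
    qed
    have onB: "H c (x - u) = 0" if "c \<in> B" for c
      using expand[of c] u1(2) u0(2) that BA by (auto simp: b'_def)
    have "H b' (x - u) = 0"
    proof (cases "b' = 0")
      case True
      then show ?thesis using positive_onD(3)[OF H xuA xuA, of 0] by simp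
    next
      case False
      then have nz: "H b' b' \<noteq> 0" using positive_onD(5)[OF H b'A] by blast
      have real: "cnj (H b' b') = H b' b'" using positive_onD(4)[OF H b'A b'A] by simp
      have "cnj (H (x - u1) b') = H b' (x - u1)" using positive_onD(4)[OF H xu1 b'A] by simp
      then show ?thesis using expand[OF b'A] nz real by (simp add: k_def)
    qed
    moreover have "H u0 (x - u) = 0"
      by (rule form_vanishes_on_span[OF H BA xuA onB u0(1)])
    moreover have "H b (x - u) = H b' (x - u) + H u0 (x - u)"
      using positive_onD(2)[OF H b'A _ xuA, of u0] u0(1) spA by (auto simp: b'_def)
    ultimately have "H b (x - u) = 0" by simp
    moreover have "u \<in> vec.span (insert b B)"
      unfolding u_def using u1(1) mono b'_span by (intro vec.span_add vec.span_scale) auto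
    ultimately show "\<exists>u \<in> vec.span (insert b B). \<forall>c \<in> insert b B. H c (x - u) = 0"
      using onB by blast
  qed
qed

lemma orth_decomposition:
  assumes H: "positive_on A H" and U: "vec.subspace U" "U \<subseteq> A" and x: "x \<in> A"
  obtains u w where "u \<in> U" "w \<in> orth A H U" "x = u + w"
proof -
  obtain B where B: "B \<subseteq> U" "vec.independent B" "U \<subseteq> vec.span B"
    using vec.basis_exists by metis
  have fin: "finite B" using B(2) by (rule vec.finiteI_independent)
  have BA: "B \<subseteq> A" using B(1) U(2) by blast
  have sp: "vec.span B = U" using B(1,3) U(1) by (metis vec.span_minimal subset_antisym)
  obtain u where u: "u \<in> vec.span B" "\<forall>b \<in> B. H b (x - u) = 0"
    using orthogonal_projection_exists[OF H fin BA] x by blast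
  have xu: "x - u \<in> A"
    using x u(1) U(2) positive_onD(1)[OF H] unfolding sp by (auto intro: vec.subspace_diff)
  have "x - u \<in> orth A H U"
    using form_vanishes_on_span[OF H BA xu] u(2) xu unfolding orth_def sp by blast
  then show thesis using that[of u "x - u"] u(1) sp by simp
qed

lemma orth_Int_trivial:
  assumes H: "positive_on A H" and "U \<subseteq> A" and "u \<in> U" "u \<in> orth A H U"
  shows "u = 0"
  using positive_onD(5)[OF H, of u] assms by (auto simp: orth_def)

text \<open>
  Orthogonal subspaces that together span everything are complements of each other: a vector
  \<open>u + u'\<close> orthogonal to \<open>U\<close> satisfies \<open>H u u = 0\<close>.
\<close>

lemma orth_eqI:
  assumes H: "positive_on A H" and U: "U \<subseteq> A" and U': "vec.subspace U'" "U' \<subseteq> A"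
    and perp: "\<And>u u'. u \<in> U \<Longrightarrow> u' \<in> U' \<Longrightarrow> H u u' = 0"
    and sum: "\<And>v. v \<in> A \<Longrightarrow> \<exists>u \<in> U. \<exists>u' \<in> U'. v = u + u'"
  shows "U' = orth A H U"
proof
  show "U' \<subseteq> orth A H U" using U'(2) perp by (auto simp: orth_def)
  show "orth A H U \<subseteq> U'"
  proof
    fix v assume v: "v \<in> orth A H U"
    then obtain u u' where uu: "u \<in> U" "u' \<in> U'" "v = u + u'"
      using sum unfolding orth_def by blast
    have "H u v = H u u + H u u'"
      unfolding uu(3) using uu(1,2) U U'(2) by (intro positive_on_right(1)[OF H]) auto
    then have "H u u = 0" using v uu(1) perp[OF uu(1,2)] by (simp add: orth_def)
    then have "u = 0" using positive_onD(5)[OF H] uu(1) U by blast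
    then show "v \<in> U'" using uu(2,3) by simp
  qed
qed

lemma orth_orth:
  assumes H: "positive_on A H" and U: "vec.subspace U" "U \<subseteq> A"
  shows "orth A H (orth A H U) = U"
proof (rule orth_eqI[OF H _ U, symmetric])
  show "orth A H U \<subseteq> A" by (auto simp: orth_def)
next
  fix u u' assume "u \<in> orth A H U" "u' \<in> U"
  then show "H u u' = 0"
    using positive_onD(4)[OF H, of u' u] U(2) by (auto simp: orth_def)
next
  fix v assume "v \<in> A"
  then obtain u w where "u \<in> U" "w \<in> orth A H U" "v = u + w" by (rule orth_decomposition[OF H U])
  then show "\<exists>u \<in> orth A H U. \<exists>u' \<in> U. v = u + u'" by (metis add.commute)
qed

section \<open>Poincare reducibility\<close>

text \<open>
  The Hermitian form of a polarization, bundled with the integrality of its imaginary part on the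
  lattice, which is what makes the reducibility argument arithmetic.
\<close>

definition polarizing_form ::
  "('p, 'n::finite) ctorus \<Rightarrow> 'n factor \<Rightarrow> 'n factor \<Rightarrow> bool" where
  "polarizing_form T L H \<longleftrightarrow> positive_on (Lie T) H \<and>
     (\<forall>l \<in> lattice T. \<forall>m \<in> lattice T.
        chern_class T L l m = complex_of_real (Im (H l m)) \<and> Im (H l m) \<in> \<int>)"

lemma polarization_obtains_form:
  assumes T: "complex_torus T" and L: "polarization T L"
  obtains H where "polarizing_form T L H"
proof -
  obtain H where H: "hermitian_on (Lie T) H" "\<forall>x \<in> Lie T. x \<noteq> 0 \<longrightarrow> Re (H x x) > 0"
    and c: "\<And>l m. l \<in> lattice T \<Longrightarrow> m \<in> lattice T \<Longrightarrow>
      chern_class T L l m = complex_of_real (Im (H l m))"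
    using L unfolding polarization_def by blast
  have "Im (H l m) \<in> \<int>" if lm: "l \<in> lattice T" "m \<in> lattice T" for l m
  proof -
    have "chern_class T L l m \<in> \<int>"
      using L by (intro chern_class_integral[OF T _ lm]) (simp add: polarization_def)
    then show ?thesis unfolding c[OF lm] by simp
  qed
  then show thesis
    using that[of H] H c complex_torusD(2)[OF T] by (simp add: polarizing_form_def positive_on_def)
qed

lemma polarizing_formD:
  assumes "polarizing_form T L H"
  shows "positive_on (Lie T) H"
    "\<And>l m. l \<in> lattice T \<Longrightarrow> m \<in> lattice T \<Longrightarrow>
      chern_class T L l m = complex_of_real (Im (H l m))"
    "\<And>l m. l \<in> lattice T \<Longrightarrow> m \<in> lattice T \<Longrightarrow> Im (H l m) \<in> \<int>"
  using assms unfolding polarizing_form_def by blast+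

lemma Im_form_antisym:
  assumes "positive_on A H" "x \<in> A" "y \<in> A"
  shows "Im (H y x) = - Im (H x y)"
  using positive_onD(4)[OF assms] by simp

lemma Im_form_zero_on_span:
  assumes H: "positive_on A H" and x: "x \<in> A" and S: "S \<subseteq> A"
    and zero: "\<And>s. s \<in> S \<Longrightarrow> Im (H x s) = 0" and y: "y \<in> span S"
  shows "Im (H x y) = 0"
proof -
  have "subspace {y \<in> A. Im (H x y) = 0}"
    using real_linear_on_kernel_subspace[OF real_linear_on_Im_form[OF H x]]
      positive_onD(1)[OF H] complex_subspace_imp_subspace by blast
  then have "span S \<subseteq> {y \<in> A. Im (H x y) = 0}"
    using S zero by (intro span_minimal) auto
  then show ?thesis using y by blast
qed

text \<open>
  The orthogonal complement is cut out of the tangent space by the integral functionals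
  \<open>Im (H c _)\<close>, where \<open>c\<close> runs through finitely many lattice vectors that span \<open>U\<close>.
\<close>

lemma orth_spanned_by_lattice:
  assumes T: "complex_torus T" and H: "polarizing_form T L H"
    and U: "vec.subspace U" "U \<subseteq> Lie T" and sp: "U \<subseteq> span (lattice T \<inter> U)"
  shows "orth (Lie T) H U \<subseteq> span (lattice T \<inter> orth (Lie T) H U)"
proof
  note pos = polarizing_formD(1)[OF H]
  obtain B where B: "finite B" "B \<subseteq> lattice T" "span B = Lie T"
    using torus_lattice_basis[OF T] .
  obtain C where C: "C \<subseteq> lattice T \<inter> U" "independent C" "lattice T \<inter> U \<subseteq> span C"
    using maximal_independent_subset by blast
  have UC: "U \<subseteq> span C" using sp span_minimal[OF C(3) subspace_span] by blast
  have CA: "C \<subseteq> Lie T" using C(1) U(2) by blast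
  fix x assume x: "x \<in> orth (Lie T) H U"
  have "x \<in> span {l \<in> lattice T. l \<in> span B \<and> (\<forall>c \<in> C. Im (H c l) = 0)}"
  proof (rule integral_functionals_kernel_in_span[OF lattice_additive_subgroup[OF T] B(1,2)])
    show "finite C" using C(2) by (rule independent_imp_finite)
    show "x \<in> span B" using x B(3) by (simp add: orth_def)
  next
    fix c assume c: "c \<in> C"
    then show "real_linear_on (span B) (\<lambda>y. Im (H c y))"
      unfolding B(3) using real_linear_on_Im_form[OF pos] CA by blast
    show "Im (H c x) = 0" using x c C(1) by (auto simp: orth_def)
    fix l assume "l \<in> lattice T"
    then show "Im (H c l) \<in> \<int>" using polarizing_formD(3)[OF H] c C(1) by blast
  qed
  moreover have "{l \<in> lattice T. l \<in> span B \<and> (\<forall>c \<in> C. Im (H c l) = 0)} \<subseteq>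
      lattice T \<inter> orth (Lie T) H U"
  proof
    fix l assume "l \<in> {l \<in> lattice T. l \<in> span B \<and> (\<forall>c \<in> C. Im (H c l) = 0)}"
    then have l: "l \<in> lattice T" "\<forall>c \<in> C. Im (H c l) = 0" by simp_all
    have lA: "l \<in> Lie T" using l(1) lattice_subset_Lie by blast
    have "Im (H u l) = 0" if "u \<in> U" for u
    proof -
      have "Im (H l c) = 0" if "c \<in> C" for c
        using Im_form_antisym[OF pos, of c l] l(2) that CA lA by auto
      then have "Im (H l u) = 0"
        using Im_form_zero_on_span[OF pos lA CA] UC that by blast
      then show ?thesis using Im_form_antisym[OF pos lA, of u] that U(2) by auto
    qed
    then have "l \<in> orth (Lie T) H U" by (rule in_orth_if_Im_zero[OF pos U lA])
    then show "l \<in> lattice T \<inter> orth (Lie T) H U" using l(1) by blast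
  qed
  ultimately show "x \<in> span (lattice T \<inter> orth (Lie T) H U)" using span_mono by blast
qed

text \<open>
  By nondegeneracy, \<open>F v = 0\<close> holds as soon as the pairings of \<open>F v\<close> with a lattice basis of the
  target vanish, and these pairings are integral on the lattice of the source.
\<close>

lemma kernel_spanned_by_lattice:
  assumes S: "complex_torus S" and T: "complex_torus T" and H: "polarizing_form T L H"
    and F: "linear_lift S T f F" and lat: "F ` lattice S \<subseteq> lattice T"
  shows "{v \<in> Lie S. F v = 0} \<subseteq> span (lattice S \<inter> {v \<in> Lie S. F v = 0})"
proof
  note pos = polarizing_formD(1)[OF H]
  have lin: "linear F" using F by (simp add: linear_lift_def complex_linear_imp_linear)
  have FT: "F v \<in> Lie T" if "v \<in> Lie S" for v using F that by (auto simp: linear_lift_def)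
  obtain B where B: "finite B" "B \<subseteq> lattice S" "span B = Lie S"
    using torus_lattice_basis[OF S] .
  obtain C where C: "finite C" "C \<subseteq> lattice T" "span C = Lie T"
    using torus_lattice_basis[OF T] .
  have CA: "C \<subseteq> Lie T" using C(2) lattice_subset_Lie by blast
  fix x assume x: "x \<in> {v \<in> Lie S. F v = 0}"
  have "x \<in> span {l \<in> lattice S. l \<in> span B \<and> (\<forall>c \<in> C. Im (H c (F l)) = 0)}"
  proof (rule integral_functionals_kernel_in_span[OF lattice_additive_subgroup[OF S] B(1,2) C(1)])
    show "x \<in> span B" using x B(3) by simp
  next
    fix c assume c: "c \<in> C"
    then have rl: "real_linear_on (Lie T) (\<lambda>y. Im (H c y))"
      using real_linear_on_Im_form[OF pos] CA by blast
    then show "real_linear_on (span B) (\<lambda>y. Im (H c (F y)))"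
      unfolding B(3) real_linear_on_def by (simp add: FT linear_add[OF lin] linear_scale[OF lin])
    show "Im (H c (F x)) = 0"
      using real_linear_on_diff[OF rl torus_Lie_subspace[OF T], of 0 0]
        subspace_0[OF torus_Lie_subspace[OF T]] x by simp
    fix l assume "l \<in> lattice S"
    then show "Im (H c (F l)) \<in> \<int>" using polarizing_formD(3)[OF H] c C(2) lat by blast
  qed
  moreover have "{l \<in> lattice S. l \<in> span B \<and> (\<forall>c \<in> C. Im (H c (F l)) = 0)} \<subseteq>
      lattice S \<inter> {v \<in> Lie S. F v = 0}"
  proof
    fix l assume "l \<in> {l \<in> lattice S. l \<in> span B \<and> (\<forall>c \<in> C. Im (H c (F l)) = 0)}"
    then have l: "l \<in> lattice S" "\<forall>c \<in> C. Im (H c (F l)) = 0" by simp_all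
    have lS: "l \<in> Lie S" using l(1) lattice_subset_Lie by blast
    have "Im (H w (F l)) = 0" if "w \<in> Lie T" for w
    proof -
      have "Im (H (F l) c) = 0" if "c \<in> C" for c
        using Im_form_antisym[OF pos, of c "F l"] l(2) that CA FT[OF lS] by auto
      then have "Im (H (F l) w) = 0"
        using Im_form_zero_on_span[OF pos FT[OF lS] CA] C(3) that by blast
      then show ?thesis using Im_form_antisym[OF pos FT[OF lS] that] by simp
    qed
    then have "F l \<in> orth (Lie T) H (Lie T)"
      by (intro in_orth_if_Im_zero[OF pos complex_torusD(2)[OF T] subset_refl FT[OF lS]])
    then have "F l = 0" using orth_Int_trivial[OF pos subset_refl FT[OF lS]] by blast
    then show "l \<in> lattice S \<inter> {v \<in> Lie S. F v = 0}" using l(1) lS by blast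
  qed
  ultimately show "x \<in> span (lattice S \<inter> {v \<in> Lie S. F v = 0})" using span_mono by blast
qed

text \<open>
  The bundle itself restricts: the lattice and the tangent space of the subtorus are contained in
  those of \<open>T\<close>, and a logarithm on the larger tangent space is one on the smaller.
\<close>

lemma polarization_sub_torus:
  assumes T: "complex_torus T" and SZ: "complex_torus (sub_torus T Z)" and L: "polarization T L"
  shows "polarization (sub_torus T Z) L"
proof -
  let ?S = "sub_torus T Z"
  have Lie: "Lie ?S \<subseteq> Lie T" by (auto simp: Lie_sub_torus)
  have lat: "lattice ?S \<subseteq> lattice T" by (auto simp: lattice_sub_torus)
  have LB: "line_bundle T L" using L by (simp add: polarization_def)
  have "\<exists>D. Vector_Spaces.linear (*s) (*) D \<and> (L l has_derivative D) (at v within Lie ?S)"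
    if "l \<in> lattice ?S" "v \<in> Lie ?S" for l v
  proof -
    have "l \<in> lattice T" "v \<in> Lie T" using that Lie lat by blast+
    then obtain D where "Vector_Spaces.linear (*s) (*) D"
        "(L l has_derivative D) (at v within Lie T)"
      using LB unfolding line_bundle_def by meson
    then show ?thesis using has_derivative_subset[OF _ Lie] by blast
  qed
  then have "line_bundle ?S L"
    using LB Lie lat unfolding line_bundle_def by (simp add: subset_iff)
  moreover have "chern_class ?S L l m = chern_class T L l m"
    if lm: "l \<in> lattice ?S" "m \<in> lattice ?S" for l m
  proof -
    have log: "continuous_log ?S L k (bundle_log T L k)" if "k \<in> lattice ?S" for k
    proof -
      have "k \<in> lattice T" using that lat by blast
      then have "continuous_log T L k (bundle_log T L k)"
        by (rule has_logsD[OF line_bundle_has_logs[OF torus_Lie_subspace[OF T] LB]])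
      then show ?thesis
        using Lie unfolding continuous_log_def by (blast intro: continuous_on_subset)
    qed
    have lm': "l \<in> Lie ?S" "m \<in> Lie ?S" using lm lattice_subset_Lie by blast+
    show ?thesis
      using chern_class_eq[OF torus_Lie_subspace[OF SZ] lm' log[OF lm(1)] log[OF lm(2)]]
      by (simp add: chern_class_def)
  qed
  moreover obtain H where H: "hermitian_on (Lie T) H" "\<forall>x \<in> Lie T. x \<noteq> 0 \<longrightarrow> Re (H x x) > 0"
    and c: "\<forall>l \<in> lattice T. \<forall>m \<in> lattice T. chern_class T L l m = complex_of_real (Im (H l m))"
    using L unfolding polarization_def by blast
  moreover have "hermitian_on (Lie ?S) H"
    using H(1) Lie unfolding hermitian_on_def by blast
  ultimately show ?thesis
    unfolding polarization_def using Lie lat by (intro conjI exI[of _ H]) (simp_all add: subset_iff)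
qed

lemma abelian_subvariety_expm_image:
  assumes T: "complex_torus T" and L: "polarization T L"
    and U: "vec.subspace U" "U \<subseteq> Lie T" "U \<subseteq> span (lattice T \<inter> U)"
  shows "abelian_subvariety T (expm T ` U)"
  unfolding abelian_subvariety_def abelian_variety_def
  using expm_image_subgroup[OF T complex_subspace_imp_subspace[OF U(1)] U(2)]
    complex_torus_sub_torus[OF T U] polarization_sub_torus[OF T complex_torus_sub_torus[OF T U] L]
  by blast

text \<open>
  The two classes have the alternating forms \<open>E (l + l', m + m')\<close> and \<open>E (l, m) + E (l', m')\<close> on
  the lattice of the product, so the mixed terms have to vanish.
\<close>

lemma NS_eq_sum_map_iff:
  assumes T: "complex_torus T" and L: "polarization T L" and H: "polarizing_form T L H"
    and X: "complex_torus (sub_torus T X)" and X': "complex_torus (sub_torus T X')"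
  defines "SX \<equiv> sub_torus T X" and "SX' \<equiv> sub_torus T X'"
  defines "P \<equiv> prod_torus SX SX'"
  shows "NS_eq P (pullback P T (sum_map T) L)
      (tensor (pullback P SX fst (restrict_bundle T X L))
              (pullback P SX' snd (restrict_bundle T X' L)))
    \<longleftrightarrow> (\<forall>l \<in> lattice SX. \<forall>l' \<in> lattice SX'. \<forall>m \<in> lattice SX. \<forall>m' \<in> lattice SX'.
           Im (H l m') + Im (H l' m) = 0)"
    (is "NS_eq P ?M ?N \<longleftrightarrow> ?rhs")
proof -
  note pos = polarizing_formD(1)[OF H]
  note LX = torus_Lie_subspace[OF X] and LX' = torus_Lie_subspace[OF X']
  have LP: "subspace (Lie P)"
    unfolding P_def SX_def SX'_def using LX LX' by (rule prod_torus_Lie_subspace)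
  have logs: "has_logs T L"
    using line_bundle_has_logs[OF torus_Lie_subspace[OF T]] L by (simp add: polarization_def)
  have lat: "lattice SX \<subseteq> lattice T" "lattice SX' \<subseteq> lattice T"
    by (auto simp: SX_def SX'_def lattice_sub_torus)
  have latP: "z \<in> lattice P \<longleftrightarrow> vfst z \<in> lattice SX \<and> vsnd z \<in> lattice SX'" for z
    by (simp add: P_def lattice_prod_torus)
  have addT: "l + m \<in> lattice T" if "l \<in> lattice T" "m \<in> lattice T" for l m
    using additive_subgroup_add[OF lattice_additive_subgroup[OF T]] that .
  have M: "chern_class P ?M z w = chern_class T L (vfst z + vsnd z) (vfst w + vsnd w)"
    if "z \<in> lattice P" "w \<in> lattice P" for z w
  proof (rule chern_class_pullback[OF T LP _ _ logs that])
    show "linear_lift P T (sum_map T) (\<lambda>z. vfst z + vsnd z)"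
      unfolding P_def SX_def SX'_def by (rule linear_lift_sum_map[OF T])
    show "(\<lambda>z. vfst z + vsnd z) ` lattice P \<subseteq> lattice T" using latP lat addT by blast
  qed
  have restr: "has_logs (sub_torus T Z) (restrict_bundle T Z L)"
    "\<And>l m. l \<in> lattice (sub_torus T Z) \<Longrightarrow> m \<in> lattice (sub_torus T Z) \<Longrightarrow>
      chern_class (sub_torus T Z) (restrict_bundle T Z L) l m = chern_class T L l m"
    if Z: "complex_torus (sub_torus T Z)" for Z
    using has_logs_pullback[OF T torus_Lie_subspace[OF Z] linear_lift_inclusion
        lattice_sub_torus_subset logs]
      chern_class_pullback[OF T torus_Lie_subspace[OF Z] linear_lift_inclusion
        lattice_sub_torus_subset logs]
    by (simp_all add: restrict_bundle_def)
  have lf: "linear_lift P SX fst vfst" "vfst ` lattice P \<subseteq> lattice SX"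
    and ls: "linear_lift P SX' snd vsnd" "vsnd ` lattice P \<subseteq> lattice SX'"
    using linear_lift_fst linear_lift_snd latP by (auto simp: P_def)
  have X1: "complex_torus SX" "complex_torus SX'" using X X' by (simp_all add: SX_def SX'_def)
  have rX: "has_logs SX (restrict_bundle T X L)" "has_logs SX' (restrict_bundle T X' L)"
    using restr(1)[OF X] restr(1)[OF X'] by (simp_all add: SX_def SX'_def)
  have N: "chern_class P ?N z w =
      chern_class T L (vfst z) (vfst w) + chern_class T L (vsnd z) (vsnd w)"
    if zw: "z \<in> lattice P" "w \<in> lattice P" for z w
  proof -
    have "chern_class P ?N z w =
        chern_class P (pullback P SX fst (restrict_bundle T X L)) z w +
        chern_class P (pullback P SX' snd (restrict_bundle T X' L)) z w"
      by (intro chern_class_tensor LP zw has_logs_pullback[OF X1(1) LP lf rX(1)]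
          has_logs_pullback[OF X1(2) LP ls rX(2)])
    also have "chern_class P (pullback P SX fst (restrict_bundle T X L)) z w =
        chern_class T L (vfst z) (vfst w)"
      using chern_class_pullback[OF X1(1) LP lf rX(1) zw] restr(2)[OF X] zw latP
      by (simp add: SX_def)
    also have "chern_class P (pullback P SX' snd (restrict_bundle T X' L)) z w =
        chern_class T L (vsnd z) (vsnd w)"
      using chern_class_pullback[OF X1(2) LP ls rX(2) zw] restr(2)[OF X'] zw latP
      by (simp add: SX'_def)
    finally show ?thesis .
  qed
  have eq: "chern_class T L (l + l') (m + m') = chern_class T L l m + chern_class T L l' m'
      \<longleftrightarrow> Im (H l m') + Im (H l' m) = 0"
    if "l \<in> lattice T" "l' \<in> lattice T" "m \<in> lattice T" "m' \<in> lattice T" for l l' m m'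
  proof -
    have A: "l \<in> Lie T" "l' \<in> Lie T" "m \<in> Lie T" "m' \<in> Lie T" "m + m' \<in> Lie T"
      using that addT lattice_subset_Lie by blast+
    have "Im (H (l + l') (m + m')) = Im (H l m) + Im (H l m') + Im (H l' m) + Im (H l' m')"
      using positive_onD(2)[OF pos A(1,2,5)] positive_on_right(1)[OF pos A(1,3,4)]
        positive_on_right(1)[OF pos A(2,3,4)] by simp
    then show ?thesis
      using that addT by (simp add: polarizing_formD(2)[OF H] flip: of_real_add)
  qed
  show ?thesis
  proof
    assume ns: "NS_eq P ?M ?N"
    show ?rhs
    proof (intro ballI)
      fix l l' m m'
      assume lm: "l \<in> lattice SX" "l' \<in> lattice SX'" "m \<in> lattice SX" "m' \<in> lattice SX'"
      have "vpair l l' \<in> lattice P" "vpair m m' \<in> lattice P" using lm latP by simp_all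
      then have "chern_class T L (l + l') (m + m') = chern_class T L l m + chern_class T L l' m'"
        using ns M[of "vpair l l'" "vpair m m'"] N[of "vpair l l'" "vpair m m'"]
        unfolding NS_eq_def by simp
      then show "Im (H l m') + Im (H l' m) = 0" using eq[of l l' m m'] lm lat by blast
    qed
  next
    assume rhs: ?rhs
    show "NS_eq P ?M ?N"
      unfolding NS_eq_def
    proof (intro ballI)
      fix z w assume zw: "z \<in> lattice P" "w \<in> lattice P"
      then have mem: "vfst z \<in> lattice SX" "vsnd z \<in> lattice SX'" "vfst w \<in> lattice SX"
        "vsnd w \<in> lattice SX'" using latP by blast+
      then have "Im (H (vfst z) (vsnd w)) + Im (H (vsnd z) (vfst w)) = 0" using rhs by blast
      then show "chern_class P ?M z w = chern_class P ?N z w"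
        unfolding M[OF zw] N[OF zw] using eq mem lat by blast
    qed
  qed
qed

text \<open>
  The sum map lifts to addition on \<open>U\<close> and its complement, which is bijective onto the tangent
  space, and the mixed terms of the Chern class vanish by orthogonality.
\<close>

lemma complementary_orth:
  assumes T: "complex_torus T" and L: "polarization T L" and H: "polarizing_form T L H"
    and U: "vec.subspace U" "U \<subseteq> Lie T" "U \<subseteq> span (lattice T \<inter> U)"
  shows "complementary T L (expm T ` U) (expm T ` orth (Lie T) H U)"
proof -
  note pos = polarizing_formD(1)[OF H]
  define U' where "U' = orth (Lie T) H U"
  have U': "vec.subspace U'" "U' \<subseteq> Lie T" "U' \<subseteq> span (lattice T \<inter> U')"
    using orth_subspace[OF pos U(2)] orth_spanned_by_lattice[OF T H U]
    by (auto simp: U'_def orth_def)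
  have R: "subspace U" "subspace U'" using U(1) U'(1) complex_subspace_imp_subspace by blast+
  define X where "X = expm T ` U"
  define X' where "X' = expm T ` U'"
  define SX where "SX = sub_torus T X"
  define SX' where "SX' = sub_torus T X'"
  have Lie: "Lie SX = U" "Lie SX' = U'"
    unfolding SX_def SX'_def X_def X'_def
    using Lie_sub_torus_expm_image[OF T] R U(2) U'(2) by blast+
  have sub: "abelian_subvariety T X" "abelian_subvariety T X'"
    unfolding X_def X'_def
    using abelian_subvariety_expm_image[OF T L] U U' by blast+
  note tor = abelian_subvarietyD(2)[OF sub(1)] abelian_subvarietyD(2)[OF sub(2)]
  have zero: "Im (H u v) = 0" "Im (H v u) = 0" if "u \<in> U" "v \<in> U'" for u v
  proof -
    show "Im (H u v) = 0" using that by (simp add: U'_def orth_def)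
    then show "Im (H v u) = 0" using Im_form_antisym[OF pos, of u v] that U(2) U'(2) by auto
  qed
  have ns: "NS_eq (prod_torus SX SX') (pullback (prod_torus SX SX') T (sum_map T) L)
      (tensor (pullback (prod_torus SX SX') SX fst (restrict_bundle T X L))
              (pullback (prod_torus SX SX') SX' snd (restrict_bundle T X' L)))"
    unfolding SX_def SX'_def NS_eq_sum_map_iff[OF T L H tor]
    using zero lattice_subset_Lie[of SX] lattice_subset_Lie[of SX'] Lie
    unfolding SX_def SX'_def by (simp add: subset_iff)
  obtain D where D: "bounded D" "D \<subseteq> Lie (prod_torus SX SX')"
      "carrier (prod_torus SX SX') \<subseteq> expm (prod_torus SX SX') ` D"
    using prod_torus_bounded_domain[of SX SX'] tor unfolding SX_def SX'_def by blast
  have "isogeny (prod_torus SX SX') T (sum_map T)"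
  proof (rule linear_lift_isogeny[OF T _ D])
    show "subspace (Lie (prod_torus SX SX'))"
      by (intro prod_torus_Lie_subspace) (simp_all add: Lie R)
    show "sum_map T \<in> hom (prod_torus SX SX') T"
      unfolding SX_def SX'_def
      by (rule sum_map_hom[OF T abelian_subvarietyD(1)[OF sub(1)] abelian_subvarietyD(1)[OF sub(2)]])
    show "linear_lift (prod_torus SX SX') T (sum_map T) (\<lambda>z. vfst z + vsnd z)"
      unfolding SX_def SX'_def by (rule linear_lift_sum_map[OF T])
    show "sum_map T ` carrier (prod_torus SX SX') = carrier T"
    proof
      show "sum_map T ` carrier (prod_torus SX SX') \<subseteq> carrier T"
        by (rule hom_carrier) fact
      show "carrier T \<subseteq> sum_map T ` carrier (prod_torus SX SX')"
      proof
        fix p assume "p \<in> carrier T"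
        then obtain v where v: "v \<in> Lie T" "p = expm T v" using complex_torusD(3)[OF T] by blast
        obtain u w where uw: "u \<in> U" "w \<in> U'" "v = u + w"
          using orth_decomposition[OF pos U(1,2) v(1)] unfolding U'_def by blast
        have "p = sum_map T (expm T u, expm T w)"
          using complex_torusD(4)[OF T, of u w] uw U(2) U'(2) v(2) by (auto simp: sum_map_def)
        then show "p \<in> sum_map T ` carrier (prod_torus SX SX')"
          using uw by (auto simp: SX_def SX'_def X_def X'_def)
      qed
    qed
  next
    fix z assume z: "z \<in> Lie (prod_torus SX SX')" "vfst z + vsnd z = 0"
    then have mem: "vfst z \<in> U" "vsnd z \<in> U'" by (simp_all add: Lie_prod_torus Lie)
    have "vfst z = - vsnd z" using z(2) by (simp add: eq_neg_iff_add_eq_0)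
    then have "vfst z \<in> U'" using mem(2) subspace_neg[OF R(2)] by simp
    then have "vfst z = 0"
      using orth_Int_trivial[OF pos U(2) mem(1)] by (simp add: U'_def)
    then show "z = 0" using z(2) by (intro vec_sum_eqI) simp_all
  qed
  then show ?thesis
    unfolding complementary_def Let_def using sub ns
    by (simp add: SX_def SX'_def X_def X'_def U'_def)
qed

text \<open>
  The mixed terms of the Chern class, taken with one vector of each pair equal to 0, show that the
  lattices of \<open>X\<close> and \<open>X'\<close> are orthogonal, hence their tangent spaces are.  Surjectivity of the
  sum map forces the tangent spaces to span: otherwise the lines in the tangent space of \<open>T\<close> would
  be covered by countably many translates of a proper subspace.
\<close>

lemma complementaryD:
  assumes T: "complex_torus T" and L: "polarization T L" and H: "polarizing_form T L H"
    and comp: "complementary T L X X'"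
  shows "abelian_subvariety T X" "abelian_subvariety T X'"
    "sum_map T ` (X \<times> X') = carrier T"
    "Lie (sub_torus T X') = orth (Lie T) H (Lie (sub_torus T X))"
    "Lie (sub_torus T X) = orth (Lie T) H (Lie (sub_torus T X'))"
    "\<And>v. v \<in> Lie T \<Longrightarrow> \<exists>u \<in> Lie (sub_torus T X). \<exists>u' \<in> Lie (sub_torus T X'). v = u + u'"
proof -
  note pos = polarizing_formD(1)[OF H]
  let ?U = "Lie (sub_torus T X)" and ?U' = "Lie (sub_torus T X')"
  show sub: "abelian_subvariety T X" "abelian_subvariety T X'"
    and onto: "sum_map T ` (X \<times> X') = carrier T"
    using comp unfolding complementary_def Let_def isogeny_def by simp_all
  note U = abelian_subvarietyD[OF sub(1)] and U' = abelian_subvarietyD[OF sub(2)]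
  have R: "subspace ?U" "subspace ?U'"
    using U(3) U'(3) complex_subspace_imp_subspace by blast+
  have lat: "lattice (sub_torus T X) \<subseteq> Lie T" "lattice (sub_torus T X') \<subseteq> Lie T"
    using lattice_subset_Lie U(4) U'(4) by blast+
  have cross: "Im (H l m') + Im (H l' m) = 0"
    if "l \<in> lattice (sub_torus T X)" "l' \<in> lattice (sub_torus T X')"
      "m \<in> lattice (sub_torus T X)" "m' \<in> lattice (sub_torus T X')" for l l' m m'
    using comp that NS_eq_sum_map_iff[OF T L H U(2) U'(2)] unfolding complementary_def Let_def
    by blast
  have lat0: "0 \<in> lattice (sub_torus T X)" "0 \<in> lattice (sub_torus T X')"
    using lattice_additive_subgroup[OF U(2)] lattice_additive_subgroup[OF U'(2)]
    by (simp_all add: additive_subgroup_def)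
  have "H 0 0 = 0"
    using positive_onD(3)[OF pos, of 0 0 0] subspace_0[OF torus_Lie_subspace[OF T]] by simp
  then have "Im (H l m') = 0" if "l \<in> lattice (sub_torus T X)" "m' \<in> lattice (sub_torus T X')"
    for l m' using cross[OF that(1) lat0(2) lat0(1) that(2)] by simp
  then have 1: "Im (H l v) = 0" if "l \<in> lattice (sub_torus T X)" "v \<in> ?U'" for l v
    using Im_form_zero_on_span[OF pos _ lat(2)] that lat(1) complex_torusD(6)[OF U'(2)] by blast
  have 2: "Im (H u v) = 0" if "u \<in> ?U" "v \<in> ?U'" for u v
  proof -
    have A: "u \<in> Lie T" "v \<in> Lie T" using that U(4) U'(4) by blast+
    have "Im (H v l) = 0" if "l \<in> lattice (sub_torus T X)" for l
      using 1[OF that \<open>v \<in> ?U'\<close>] Im_form_antisym[OF pos, of l v] lat(1) that A(2) by auto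
    then have "Im (H v u) = 0"
      using Im_form_zero_on_span[OF pos A(2) lat(1)] that(1) complex_torusD(6)[OF U(2)] by blast
    then show ?thesis using Im_form_antisym[OF pos A(2,1)] by simp
  qed
  have perp: "H u v = 0" if "u \<in> ?U" "v \<in> ?U'" for u v
    using in_orth_if_Im_zero[OF pos U(3,4) _ 2] that U'(4) unfolding orth_def by blast
  have perp': "H v u = 0" if "v \<in> ?U'" "u \<in> ?U" for u v
    using positive_onD(4)[OF pos, of u v] perp[OF that(2,1)] that U(4) U'(4) by auto
  show sum: "\<exists>u \<in> ?U. \<exists>u' \<in> ?U'. v = u + u'" if v: "v \<in> Lie T" for v
  proof -
    define S where "S = {u + u' | u u'. u \<in> ?U \<and> u' \<in> ?U'}"
    have "v \<in> S"
    proof (rule line_in_subspace_mod_lattice[OF T _ _ v])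
      show "subspace S" unfolding S_def using R by (rule subspace_sums)
      show "S \<subseteq> Lie T"
        unfolding S_def using U(4) U'(4) subspace_add[OF torus_Lie_subspace[OF T]] by blast
    next
      fix t :: real
      have "expm T (t *\<^sub>R v) \<in> sum_map T ` (X \<times> X')"
        unfolding onto by (rule expm_closed[OF T subspace_scale[OF torus_Lie_subspace[OF T] v]])
      then obtain x x' where "x \<in> X" "x' \<in> X'" "expm T (t *\<^sub>R v) = x \<otimes>\<^bsub>T\<^esub> x'"
        by (auto simp: sum_map_def)
      moreover from this obtain u u' where "u \<in> ?U" "x = expm T u" "u' \<in> ?U'" "x' = expm T u'"
        using U(5) U'(5) by blast
      ultimately have uu: "u \<in> ?U" "u' \<in> ?U'"
          "expm T (t *\<^sub>R v) = expm T u \<otimes>\<^bsub>T\<^esub> expm T u'"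
        by simp_all
      then have "expm T (t *\<^sub>R v) = expm T (u + u')"
        using complex_torusD(4)[OF T, of u u'] U(4) U'(4) by (simp add: subset_iff)
      then show "expm T (t *\<^sub>R v) \<in> expm T ` S" using uu by (auto simp: S_def)
    qed
    then show ?thesis by (auto simp: S_def)
  qed
  show "?U' = orth (Lie T) H ?U"
    by (rule orth_eqI[OF pos U(4) U'(3,4) perp sum])
  show "?U = orth (Lie T) H ?U'"
  proof (rule orth_eqI[OF pos U'(4) U(3,4) perp'])
    fix v assume "v \<in> Lie T"
    then show "\<exists>u \<in> ?U'. \<exists>u' \<in> ?U. v = u + u'" using sum by (metis add.commute)
  qed
qed

section \<open>The canonical diagram of a morphism\<close>

lemma hom_one_torus:
  assumes "complex_torus S" "complex_torus T" "f \<in> hom S T"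
  shows "f \<one>\<^bsub>S\<^esub> = \<one>\<^bsub>T\<^esub>"
  by (intro hom_one[OF assms(3)] torus_group assms)

lemma complex_subspace_kernel:
  assumes F: "Vector_Spaces.linear (*s) (*s) F" and U: "vec.subspace U"
  shows "vec.subspace {v \<in> U. F v = 0}"
proof -
  interpret F: Vector_Spaces.linear "(*s)" "(*s)" F by fact
  show ?thesis
    by (rule vec.subspaceI)
      (auto simp: F.zero F.add F.scale
        intro: vec.subspace_0[OF U] vec.subspace_add[OF U] vec.subspace_scale[OF U])
qed

lemma linear_lift_image_spanned_by_lattice:
  assumes S: "complex_torus S" and F: "linear_lift S T f F" and lat: "F ` lattice S \<subseteq> lattice T"
  shows "F ` Lie S \<subseteq> span (lattice T \<inter> F ` Lie S)"
proof -
  have lin: "linear F" using F by (simp add: linear_lift_def complex_linear_imp_linear)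
  have "F ` Lie S = span (F ` lattice S)"
    unfolding complex_torusD(6)[OF S, symmetric] by (rule linear_span_image[OF lin, symmetric])
  also have "\<dots> \<subseteq> span (lattice T \<inter> F ` Lie S)"
    using lat lattice_subset_Lie by (intro span_mono) blast
  finally show ?thesis .
qed

context
  fixes V :: "('p, 'n::finite) ctorus" and W :: "('q, 'm::finite) ctorus"
    and L :: "'n factor" and M :: "'m factor" and f :: "'p \<Rightarrow> 'q" and F HV HW
  assumes V: "complex_torus V" and W: "complex_torus W"
    and L: "polarization V L" and M: "polarization W M"
    and HV: "polarizing_form V L HV" and HW: "polarizing_form W M HW"
    and hom: "f \<in> hom V W" and F: "linear_lift V W f F"
begin

text \<open>
  On the orthogonal complement of its kernel, \<open>F\<close> is injective and keeps its image; the first makes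
  the kernel of the restriction of \<open>f\<close> to \<open>X\<close> finite and the second makes that restriction map
  onto \<open>Y\<close>.
\<close>

lemma diagram_exists:
  defines "K \<equiv> {v \<in> Lie V. F v = 0}" and "R \<equiv> F ` Lie V"
  defines "X \<equiv> expm V ` orth (Lie V) HV K" and "X' \<equiv> expm V ` K"
    and "Y \<equiv> expm W ` R" and "Y' \<equiv> expm W ` orth (Lie W) HW R"
  shows "complementary V L X X'" "complementary W M Y Y'"
    "isogeny (sub_torus V X) (sub_torus W Y) (restrict f X)"
    "\<And>x'. x' \<in> X' \<Longrightarrow> f x' = \<one>\<^bsub>W\<^esub>"
proof -
  note posV = polarizing_formD(1)[OF HV] and posW = polarizing_formD(1)[OF HW]
  note f1 = hom_one_torus[OF V W hom]
  have clin: "Vector_Spaces.linear (*s) (*s) F" using F by (simp add: linear_lift_def)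
  have lin: "linear F" using clin by (rule complex_linear_imp_linear)
  have lat: "F ` lattice V \<subseteq> lattice W" using linear_lift_lattice[OF F f1] by blast
  have fexp: "f (expm V v) = expm W (F v)" if "v \<in> Lie V" for v
    using F that by (simp add: linear_lift_def)
  have K: "vec.subspace K" "K \<subseteq> Lie V" "K \<subseteq> span (lattice V \<inter> K)"
    using complex_subspace_kernel[OF clin complex_torusD(2)[OF V]]
      kernel_spanned_by_lattice[OF V W HW F lat] by (auto simp: K_def)
  define U where "U = orth (Lie V) HV K"
  have U: "vec.subspace U" "U \<subseteq> Lie V" "U \<subseteq> span (lattice V \<inter> U)"
    using orth_subspace[OF posV K(2)] orth_spanned_by_lattice[OF V HV K]
    by (auto simp: U_def orth_def)
  have orthU: "orth (Lie V) HV U = K" unfolding U_def by (rule orth_orth[OF posV K(1,2)])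
  have R: "vec.subspace R" "R \<subseteq> Lie W" "R \<subseteq> span (lattice W \<inter> R)"
    using complex_subspace_image[OF clin complex_torusD(2)[OF V]] F
      linear_lift_image_spanned_by_lattice[OF V F lat] by (auto simp: R_def linear_lift_def)
  show comp: "complementary V L X X'" "complementary W M Y Y'"
    using complementary_orth[OF V L HV U] complementary_orth[OF W M HW R] orthU
    by (simp_all add: X_def X'_def Y_def Y'_def U_def)
  show "f x' = \<one>\<^bsub>W\<^esub>" if "x' \<in> X'" for x'
    using that fexp by (auto simp: X'_def K_def expm_zero[OF W])
  have rU: "subspace U" and rR: "subspace R"
    using U(1) R(1) complex_subspace_imp_subspace by blast+
  have X_U: "X = expm V ` U" by (simp add: X_def U_def)
  have LieX: "Lie (sub_torus V X) = U"
    unfolding X_U by (rule Lie_sub_torus_expm_image[OF V rU U(2)])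
  have LieY: "Lie (sub_torus W Y) = R"
    unfolding Y_def by (rule Lie_sub_torus_expm_image[OF W rR R(2)])
  have torX: "complex_torus (sub_torus V X)" and torY: "complex_torus (sub_torus W Y)"
    by (rule abelian_subvarietyD(2)[OF complementaryD(1)[OF V L HV comp(1)]],
        rule abelian_subvarietyD(2)[OF complementaryD(1)[OF W M HW comp(2)]])
  have FU: "F ` U = R"
  proof
    show "F ` U \<subseteq> R" using U(2) by (auto simp: R_def)
    show "R \<subseteq> F ` U"
    proof
      fix w assume "w \<in> R"
      then obtain v where v: "v \<in> Lie V" "w = F v" by (auto simp: R_def)
      obtain u k where "u \<in> U" "k \<in> K" "v = u + k"
        using orth_decomposition[OF posV U(1,2) v(1)] unfolding orthU by blast
      then show "w \<in> F ` U" using v(2) by (auto simp: linear_add[OF lin] K_def)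
    qed
  qed
  have fX: "f ` X = Y"
    unfolding X_U Y_def FU[symmetric] image_image using fexp U(2) by (intro image_cong) auto
  obtain D where D: "bounded D" "D \<subseteq> Lie (sub_torus V X)"
      "expm (sub_torus V X) ` D = carrier (sub_torus V X)"
    using torus_bounded_domain[OF torX] .
  have XV: "X \<subseteq> carrier V" using X_U U(2) expm_closed[OF V] by blast
  interpret SX: group "sub_torus V X" by (rule torus_group[OF torX])
  show "isogeny (sub_torus V X) (sub_torus W Y) (restrict f X)"
  proof (rule linear_lift_isogeny[OF torY torus_Lie_subspace[OF torX] D(1,2)])
    show "carrier (sub_torus V X) \<subseteq> expm (sub_torus V X) ` D" using D(3) by simp
    show "restrict f X \<in> hom (sub_torus V X) (sub_torus W Y)"
    proof (rule homI)
      fix x assume "x \<in> carrier (sub_torus V X)"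
      then show "restrict f X x \<in> carrier (sub_torus W Y)" using fX by auto
    next
      fix x y assume xy: "x \<in> carrier (sub_torus V X)" "y \<in> carrier (sub_torus V X)"
      then have "x \<otimes>\<^bsub>V\<^esub> y \<in> X" using SX.m_closed[OF xy] by simp
      then show "restrict f X (x \<otimes>\<^bsub>sub_torus V X\<^esub> y) =
          restrict f X x \<otimes>\<^bsub>sub_torus W Y\<^esub> restrict f X y"
        using xy XV hom_mult[OF hom, of x y] by (simp add: subset_iff)
    qed
    show "restrict f X ` carrier (sub_torus V X) = carrier (sub_torus W Y)" using fX by simp
    show "linear_lift (sub_torus V X) (sub_torus W Y) (restrict f X) F"
      unfolding linear_lift_def LieX LieY using clin FU fexp U(2) by (auto simp: X_U)
  next
    fix v assume v: "v \<in> Lie (sub_torus V X)" "F v = 0"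
    then have "v \<in> K" using U(2) LieX by (auto simp: K_def)
    then show "v = 0" using orth_Int_trivial[OF posV K(2)] v(1) unfolding LieX U_def by blast
  qed
qed

text \<open>
  The diagram makes \<open>f\<close> trivial on \<open>X'\<close> and of finite kernel on \<open>X\<close>, so the kernel of the lift is
  exactly the tangent space of \<open>X'\<close>; moreover \<open>Y = g ` X = f ` carrier V\<close>.  Complements are
  determined as orthogonal complements.
\<close>

lemma diagram_unique:
  assumes cV: "complementary V L X X'" and cW: "complementary W M Y Y'"
    and g: "isogeny (sub_torus V X) (sub_torus W Y) g" "g \<in> extensional X"
    and comm: "\<And>x x'. x \<in> X \<Longrightarrow> x' \<in> X' \<Longrightarrow> f (x \<otimes>\<^bsub>V\<^esub> x') = g x \<otimes>\<^bsub>W\<^esub> \<one>\<^bsub>W\<^esub>"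
  defines "K \<equiv> {v \<in> Lie V. F v = 0}" and "R \<equiv> F ` Lie V"
  shows "X = expm V ` orth (Lie V) HV K" "X' = expm V ` K"
    "Y = expm W ` R" "Y' = expm W ` orth (Lie W) HW R" "g = restrict f X"
proof -
  note dV = complementaryD[OF V L HV cV] and dW = complementaryD[OF W M HW cW]
  note X = abelian_subvarietyD[OF dV(1)] and X' = abelian_subvarietyD[OF dV(2)]
  note Y = abelian_subvarietyD[OF dW(1)] and Y' = abelian_subvarietyD[OF dW(2)]
  interpret V: group V by (rule torus_group[OF V])
  interpret W: group W by (rule torus_group[OF W])
  let ?U = "Lie (sub_torus V X)" and ?U' = "Lie (sub_torus V X')"
  have clin: "Vector_Spaces.linear (*s) (*s) F" using F by (simp add: linear_lift_def)
  have lin: "linear F" using clin by (rule complex_linear_imp_linear)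
  have FW: "F v \<in> Lie W" if "v \<in> Lie V" for v using F that by (auto simp: linear_lift_def)
  have fexp: "f (expm V v) = expm W (F v)" if "v \<in> Lie V" for v
    using F that by (simp add: linear_lift_def)
  have gX: "g ` X = Y" and gfin: "finite (kernel (sub_torus V X) (sub_torus W Y) g)"
    and ghom: "g \<in> hom (sub_torus V X) (sub_torus W Y)"
    using g(1) by (simp_all add: isogeny_def morphism_def)
  have gW: "g x \<in> carrier W" if "x \<in> X" for x
    using gX that subgroup.subset[OF Y(1)] by blast
  have comm': "f (x \<otimes>\<^bsub>V\<^esub> x') = g x" if "x \<in> X" "x' \<in> X'" for x x'
    using comm[OF that] gW[OF that(1)] by simp
  have one: "\<one>\<^bsub>V\<^esub> \<in> X" "\<one>\<^bsub>V\<^esub> \<in> X'"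
    by (rule subgroup.one_closed[OF X(1)], rule subgroup.one_closed[OF X'(1)])
  have fg: "f x = g x" if "x \<in> X" for x
    using comm'[OF that one(2)] subgroup.mem_carrier[OF X(1) that] by simp
  have fX': "f x' = \<one>\<^bsub>W\<^esub>" if "x' \<in> X'" for x'
    using comm'[OF one(1) that] subgroup.mem_carrier[OF X'(1) that]
      hom_one_torus[OF X(2) Y(2) ghom] by simp
  show "g = restrict f X"
    using g(2) fg by (intro extensionalityI[of _ X]) auto

  have "Y = f ` carrier V"
  proof
    have "Y = f ` X" unfolding gX[symmetric] using fg by (intro image_cong) simp_all
    then show "Y \<subseteq> f ` carrier V" using subgroup.subset[OF X(1)] by blast
    show "f ` carrier V \<subseteq> Y"
      unfolding dV(3)[symmetric] using comm' gX by (auto simp: sum_map_def)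
  qed
  also have "\<dots> = expm W ` R"
    unfolding complex_torusD(3)[OF V, symmetric] R_def image_image
    using fexp by (intro image_cong) auto
  finally show Y_R: "Y = expm W ` R" .
  have "subspace R"
    unfolding R_def using linear_subspace_image[OF lin torus_Lie_subspace[OF V]] .
  moreover have "R \<subseteq> Lie W" using FW by (auto simp: R_def)
  ultimately have "Lie (sub_torus W Y) = R"
    unfolding Y_R by (rule Lie_sub_torus_expm_image[OF W])
  then show "Y' = expm W ` orth (Lie W) HW R" using Y'(5) dW(4) by simp

  have U'K: "?U' \<subseteq> K"
  proof
    fix v assume v: "v \<in> ?U'"
    then have vV: "v \<in> Lie V" using X'(4) by blast
    have "F v = 0"
    proof (rule lattice_line_trivial[OF W])
      fix t :: real
      have tv: "t *\<^sub>R v \<in> Lie V" using subspace_scale[OF torus_Lie_subspace[OF V] vV] .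
      have "expm V (t *\<^sub>R v) \<in> X'" using v by (simp add: Lie_sub_torus)
      then have "expm W (F (t *\<^sub>R v)) = \<one>\<^bsub>W\<^esub>" using fX' fexp[OF tv] by simp
      then show "t *\<^sub>R F v \<in> lattice W"
        using FW[OF tv] by (simp add: lattice_def linear_scale[OF lin])
    qed
    then show "v \<in> K" using vV by (simp add: K_def)
  qed
  have UK: "u = 0" if u: "u \<in> ?U" "F u = 0" for u
  proof -
    have uV: "u \<in> Lie V" using u(1) X(4) by blast
    show ?thesis
    proof (rule line_in_finite_set[OF V uV gfin])
      fix t :: real
      have tu: "t *\<^sub>R u \<in> Lie V" using subspace_scale[OF torus_Lie_subspace[OF V] uV] .
      have x: "expm V (t *\<^sub>R u) \<in> X" using u(1) by (simp add: Lie_sub_torus)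
      have "g (expm V (t *\<^sub>R u)) = \<one>\<^bsub>W\<^esub>"
        using fg[OF x] fexp[OF tu] u(2) by (simp add: linear_scale[OF lin] expm_zero[OF W])
      then show "expm V (t *\<^sub>R u) \<in> kernel (sub_torus V X) (sub_torus W Y) g"
        using x by (simp add: kernel_def)
    qed
  qed
  have "K \<subseteq> ?U'"
  proof
    fix v assume v: "v \<in> K"
    then have "v \<in> Lie V" by (simp add: K_def)
    then obtain u u' where uu: "u \<in> ?U" "u' \<in> ?U'" "v = u + u'" using dV(6) by blast
    have "u' \<in> K" using uu(2) U'K by blast
    then have "F u = 0" using v uu(3) by (simp add: K_def linear_add[OF lin])
    then have "u = 0" using UK uu(1) by blast
    then show "v \<in> ?U'" using uu by simp
  qed
  then have "?U' = K" using U'K by blast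
  then show "X' = expm V ` K" "X = expm V ` orth (Lie V) HV K"
    using X(5) X'(5) dV(5) by simp_all
qed

end

theorem proposition7p1:
  fixes V :: "('p, 'n::finite) ctorus" and W :: "('q, 'm::finite) ctorus"
    and L\<^sub>V :: "'n factor" and L\<^sub>W :: "'m factor"
    and f :: "'p \<Rightarrow> 'q"
  assumes "abelian_variety V" and "abelian_variety W"
    and "polarization V L\<^sub>V" and "polarization W L\<^sub>W"
    and "morphism V W f"
  shows "\<exists>!D. case D of (X, X', Y, Y', g) \<Rightarrow>
    complementary V L\<^sub>V X X' \<and>
    complementary W L\<^sub>W Y Y' \<and>
    isogeny (sub_torus V X) (sub_torus W Y) g \<and> g \<in> extensional X \<and>
    (\<forall>x \<in> X. \<forall>x' \<in> X'.
       f (sum_map V (x, x')) = sum_map W ((\<lambda>(x, x'). (g x, \<one>\<^bsub>W\<^esub>)) (x, x')))"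
proof -
  have V: "complex_torus V" and W: "complex_torus W"
    using assms(1,2) by (simp_all add: abelian_variety_def)
  obtain HV where HV: "polarizing_form V L\<^sub>V HV"
    using polarization_obtains_form[OF V assms(3)] .
  obtain HW where HW: "polarizing_form W L\<^sub>W HW"
    using polarization_obtains_form[OF W assms(4)] .
  obtain F where F: "linear_lift V W f F" using morphism_linear_lift[OF V W assms(5)] .
  have hom: "f \<in> hom V W" using assms(5) by (simp add: morphism_def)
  define K where "K = {v \<in> Lie V. F v = 0}"
  define R where "R = F ` Lie V"
  define X where "X = expm V ` orth (Lie V) HV K"
  define X' where "X' = expm V ` K"
  define Y where "Y = expm W ` R"
  define Y' where "Y' = expm W ` orth (Lie W) HW R"
  note ex = diagram_exists[OF V W assms(3,4) HV HW hom F,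
      folded K_def R_def, folded X_def X'_def Y_def Y'_def]
  note unique = diagram_unique[OF V W assms(3,4) HV HW hom F,
      folded K_def R_def, folded X_def X'_def Y_def Y'_def]
  have sub: "X \<subseteq> carrier V" "X' \<subseteq> carrier V"
    using complementaryD(1,2)[OF V assms(3) HV ex(1), THEN abelian_subvarietyD(1), THEN subgroup.subset]
    by simp_all
  have comm: "f (x \<otimes>\<^bsub>V\<^esub> x') = restrict f X x \<otimes>\<^bsub>W\<^esub> \<one>\<^bsub>W\<^esub>" if "x \<in> X" "x' \<in> X'" for x x'
    using hom_mult[OF hom, of x x'] ex(4)[OF that(2)] that sub by auto
  show ?thesis
  proof (rule ex1I[of _ "(X, X', Y, Y', restrict f X)"])
    show "case (X, X', Y, Y', restrict f X) of (X, X', Y, Y', g) \<Rightarrow>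
      complementary V L\<^sub>V X X' \<and> complementary W L\<^sub>W Y Y' \<and>
      isogeny (sub_torus V X) (sub_torus W Y) g \<and> g \<in> extensional X \<and>
      (\<forall>x \<in> X. \<forall>x' \<in> X'.
         f (sum_map V (x, x')) = sum_map W ((\<lambda>(x, x'). (g x, \<one>\<^bsub>W\<^esub>)) (x, x')))"
      using ex(1-3) comm by (simp add: sum_map_def)
  next
    fix D :: "'p set \<times> 'p set \<times> 'q set \<times> 'q set \<times> ('p \<Rightarrow> 'q)"
    assume D: "case D of (X, X', Y, Y', g) \<Rightarrow>
      complementary V L\<^sub>V X X' \<and> complementary W L\<^sub>W Y Y' \<and>
      isogeny (sub_torus V X) (sub_torus W Y) g \<and> g \<in> extensional X \<and>
      (\<forall>x \<in> X. \<forall>x' \<in> X'.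
         f (sum_map V (x, x')) = sum_map W ((\<lambda>(x, x'). (g x, \<one>\<^bsub>W\<^esub>)) (x, x')))"
    obtain X1 X1' Y1 Y1' g1 where D_eq: "D = (X1, X1', Y1, Y1', g1)" by (cases D) auto
    have d: "complementary V L\<^sub>V X1 X1'" "complementary W L\<^sub>W Y1 Y1'"
      "isogeny (sub_torus V X1) (sub_torus W Y1) g1" "g1 \<in> extensional X1"
      "\<And>x x'. x \<in> X1 \<Longrightarrow> x' \<in> X1' \<Longrightarrow> f (x \<otimes>\<^bsub>V\<^esub> x') = g1 x \<otimes>\<^bsub>W\<^esub> \<one>\<^bsub>W\<^esub>"
      using D unfolding D_eq by (simp_all add: sum_map_def)
    show "D = (X, X', Y, Y', restrict f X)"
      unfolding D_eq using unique[OF d] by simp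
  qed
qed

end
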